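(* Let $K\subset\mathbb{R}^n$ be a nonempty compact set such that $\partial\,\mathrm{conv}(K)\subseteq K$. Let $\mathcal{F}=\{Q_1,\dots,Q_s\}$ be a finite family of linear subspaces of $\mathbb{R}^n$ with $1\le \dim(Q_i)\le n-2$ for all $i$, and let $\{H_m\}_{m\in\mathbb{N}}$ be a sequence with $H_m\in\mathcal{F}$ for every $m$. Then the sequence \[K_m:=F_{H_m}\cdots F_{H_1}K\] converges in the Hausdorff metric to a compact convex set $L$, and $L$ is the Hausdorff limit of the sequence $F_{H_m}\cdots F_{H_1}\mathrm{conv}(K)$. Moreover, $L$ is symmetric with respect to every subspace $Q_j\in\mathcal{F}$ that appears infinitely often in $\{H_m\}$ (i.e. $R_{Q_j}L=L$).
   Context: For a linear subspace $H\subseteq\mathbb{R}^n$, $R_H$ is the reflection with respect to $H$: $R_H x=2(x|H)-x$, where $x|H$ is the orthogonal projection of $x$ onto $H$; $H^\perp$ is the orthogonal complement. Minkowski sum: $X+Y=\{x+y:x\in X,y\in Y\}$, $tX=\{tx:x\in X\}$. The fiber symmetrization of a compact set $C$ with respect to $H$ is \[F_H C:=\bigcup_{x\in H}\Big[\tfrac12\big(C\cap(H^\perp+x)\big)+\tfrac12\big(R_H C\cap(H^\perp+x)\big)\Big].\] $\mathrm{conv}$ denotes convex hull, $\partial$ the boundary; convergence is in the Hausdorff metric. *)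

theory Defs
  imports "HOL-Analysis.Analysis"
begin

definition orth_proj :: "'a::euclidean_space set \<Rightarrow> 'a \<Rightarrow> 'a" where
  "orth_proj H x = (THE y. y \<in> H \<and> x - y \<in> orthogonal_comp H)"

definition reflect :: "'a::euclidean_space set \<Rightarrow> 'a \<Rightarrow> 'a" where
  "reflect H x = 2 *\<^sub>R orth_proj H x - x"

definition msum :: "'a::real_vector set \<Rightarrow> 'a set \<Rightarrow> 'a set" where
  "msum X Y = {x + y | x y. x \<in> X \<and> y \<in> Y}"

definition fiber_sym :: "'a::euclidean_space set \<Rightarrow> 'a set \<Rightarrow> 'a set" where
  "fiber_sym H C = (\<Union>x\<in>H.
      msum ((\<lambda>v. (1/2) *\<^sub>R v) ` (C \<inter> ((\<lambda>y. y + x) ` orthogonal_comp H)))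
           ((\<lambda>v. (1/2) *\<^sub>R v) ` (reflect H ` C \<inter> ((\<lambda>y. y + x) ` orthogonal_comp H))))"

primrec fsym_iter :: "(nat \<Rightarrow> 'a::euclidean_space set) \<Rightarrow> 'a set \<Rightarrow> nat \<Rightarrow> 'a set" where
  "fsym_iter Hs C 0 = C"
| "fsym_iter Hs C (Suc m) = fiber_sym (Hs m) (fsym_iter Hs C m)"

text \<open>Hausdorff distance (used on nonempty compact sets).\<close>
definition hausdorff_dist :: "'a::metric_space set \<Rightarrow> 'a set \<Rightarrow> real" where
  "hausdorff_dist A B = max (SUP a\<in>A. infdist a B) (SUP b\<in>B. infdist b A)"

end

theory Submission
  imports Defs "HOL-Complex_Analysis.Great_Picard"
begin

text \<open>
  If \<open>H\<close> has codimension at least two, every chord of \<open>conv K\<close> parallel to \<open>H\<^sup>\<bottom>\<close> can be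
  translated inside its fiber so that both endpoints lie on the boundary, hence in \<open>K\<close>. So
  \<open>F\<^sub>H K = F\<^sub>H (conv K)\<close>, and only convex bodies remain.

  For these, let \<open>W(C)\<close> be the maximum over orthogonal \<open>g\<close> of the integral of
  \<open>exp (h\<^sub>C (g u))\<close> over a box, where \<open>h\<^sub>C\<close> is the support function. As \<open>F\<^sub>H C\<close> is contained in
  \<open>(C + R\<^sub>H C) / 2\<close> and \<open>exp\<close> is strictly convex and increasing, \<open>W (F\<^sub>H C) \<le> W C\<close>, with equality
  only if \<open>R\<^sub>H C = C\<close>; moreover \<open>W\<close> is strictly monotone under inclusion of convex bodies.
  All limit bodies of the sequence share one value of \<open>W\<close>. Let \<open>L\<close> be one of them. Symmetrization
  by a subspace that leaves \<open>L\<close> invariant keeps a body inside the \<open>e\<close>-neighbourhood of \<open>L\<close>, and by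
  strict monotonicity this one-sided closeness already forces convergence to \<open>L\<close>. Hence the
  iterates are still close to \<open>L\<close> when the first subspace not leaving \<open>L\<close> invariant is used, and
  upper semicontinuity of \<open>F\<^sub>H\<close> together with the equality case for \<open>W\<close> contradicts its choice.
\<close>

section \<open>Reflections and fiber symmetrization\<close>

lemma orth_proj_unique:
  fixes H :: "'a::euclidean_space set"
  assumes "subspace H" "y \<in> H" "x - y \<in> H\<^sup>\<bottom>"
  shows "orth_proj H x = y"
  unfolding orth_proj_def
proof (rule the_equality)
  fix z assume z: "z \<in> H \<and> x - z \<in> H\<^sup>\<bottom>"
  have "y - z \<in> H" using assms z by (simp add: subspace_diff)
  moreover have "(x - z) - (x - y) \<in> H\<^sup>\<bottom>"
    using z assms(3) by (meson subspace_diff subspace_orthogonal_comp)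
  ultimately have "(y - z) \<bullet> (y - z) = 0"
    by (simp add: orthogonal_comp_def orthogonal_def)
  then show "z = y" by simp
qed (use assms in auto)

lemma orth_proj_decomp:
  fixes H :: "'a::euclidean_space set"
  assumes "subspace H"
  shows orth_proj_in: "orth_proj H x \<in> H"
    and diff_orth_proj_in: "x - orth_proj H x \<in> H\<^sup>\<bottom>"
proof -
  have "x \<in> H + H\<^sup>\<bottom>" using subspace_sum_orthogonal_comp[OF assms] by simp
  then obtain y z where "x = y + z" "y \<in> H" "z \<in> H\<^sup>\<bottom>" by (auto elim: set_plus_elim)
  then have "orth_proj H x = y" "x - y \<in> H\<^sup>\<bottom>" "y \<in> H"
    using orth_proj_unique[OF assms, of y x] by auto
  then show "orth_proj H x \<in> H" "x - orth_proj H x \<in> H\<^sup>\<bottom>" by auto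
qed

lemma linear_orth_proj:
  fixes H :: "'a::euclidean_space set"
  assumes "subspace H"
  shows "linear (orth_proj H)"
proof (rule linearI)
  fix x y :: 'a and c :: real
  have "(x - orth_proj H x) + (y - orth_proj H y) \<in> H\<^sup>\<bottom>"
    by (intro subspace_add subspace_orthogonal_comp diff_orth_proj_in assms)
  then show "orth_proj H (x + y) = orth_proj H x + orth_proj H y"
    using assms by (intro orth_proj_unique) (auto simp: subspace_add orth_proj_in algebra_simps)
  have "c *\<^sub>R (x - orth_proj H x) \<in> H\<^sup>\<bottom>"
    by (intro subspace_scale subspace_orthogonal_comp diff_orth_proj_in assms)
  then show "orth_proj H (c *\<^sub>R x) = c *\<^sub>R orth_proj H x"
    using assms by (intro orth_proj_unique) (auto simp: subspace_scale orth_proj_in algebra_simps)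
qed

lemma orth_proj_eq_iff:
  fixes H :: "'a::euclidean_space set"
  assumes "subspace H"
  shows "orth_proj H a = orth_proj H b \<longleftrightarrow> a - b \<in> H\<^sup>\<bottom>"
proof
  assume "orth_proj H a = orth_proj H b"
  then have "a - b = (a - orth_proj H a) - (b - orth_proj H b)" by simp
  then show "a - b \<in> H\<^sup>\<bottom>"
    using assms by (metis subspace_diff subspace_orthogonal_comp diff_orth_proj_in)
next
  assume "a - b \<in> H\<^sup>\<bottom>"
  then have "(a - b) + (b - orth_proj H b) \<in> H\<^sup>\<bottom>"
    by (intro subspace_add subspace_orthogonal_comp diff_orth_proj_in assms)
  then show "orth_proj H a = orth_proj H b"
    using assms by (intro orth_proj_unique orth_proj_in) auto
qed

lemma linear_reflect:
  fixes H :: "'a::euclidean_space set"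
  assumes "subspace H"
  shows "linear (reflect H)"
proof -
  have "linear (\<lambda>x. 2 *\<^sub>R orth_proj H x - x)"
    by (intro linear_compose_sub linear_compose_scale_right linear_orth_proj assms linear_id[unfolded id_def])
  then show ?thesis by (simp add: reflect_def[abs_def])
qed

lemma reflect_minus_in_orthogonal_comp:
  fixes H :: "'a::euclidean_space set"
  assumes "subspace H"
  shows "x - reflect H x \<in> H\<^sup>\<bottom>"
proof -
  have "x - reflect H x = 2 *\<^sub>R (x - orth_proj H x)"
    by (simp add: reflect_def algebra_simps flip: scaleR_2)
  then show ?thesis
    using assms by (simp add: subspace_scale subspace_orthogonal_comp diff_orth_proj_in)
qed

lemma orth_proj_reflect:
  fixes H :: "'a::euclidean_space set"
  assumes "subspace H"
  shows "orth_proj H (reflect H x) = orth_proj H x"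
  using orth_proj_eq_iff[OF assms] reflect_minus_in_orthogonal_comp[OF assms] by metis

lemma reflect_reflect:
  fixes H :: "'a::euclidean_space set"
  assumes "subspace H"
  shows "reflect H (reflect H x) = x"
  unfolding reflect_def[of H "reflect H x"] orth_proj_reflect[OF assms] by (simp add: reflect_def)

lemma inner_reflect_left:
  fixes H :: "'a::euclidean_space set"
  assumes "subspace H"
  shows "reflect H x \<bullet> y = x \<bullet> reflect H y"
proof -
  have "orth_proj H x \<bullet> (y - orth_proj H y) = 0" "orth_proj H y \<bullet> (x - orth_proj H x) = 0"
    using orth_proj_in[OF assms] diff_orth_proj_in[OF assms]
    by (auto simp: orthogonal_comp_def orthogonal_def)
  then show ?thesis by (simp add: reflect_def algebra_simps inner_commute)
qed

lemma norm_reflect: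
  fixes H :: "'a::euclidean_space set"
  assumes "subspace H"
  shows "norm (reflect H x) = norm x"
  by (simp add: norm_eq_sqrt_inner inner_reflect_left[OF assms] reflect_reflect[OF assms])

text \<open>\<open>reflect H\<close> preserves projections onto \<open>H\<close>, so the union over
  fibers unfolds into pairs of points of \<open>C\<close> itself with equal projection. Later
  arguments about \<open>fiber_sym\<close> run through such pairs.\<close>

lemma mem_fiber_sym_iff:
  fixes H :: "'a::euclidean_space set"
  assumes H: "subspace H"
  shows "z \<in> fiber_sym H C \<longleftrightarrow>
    (\<exists>a\<in>C. \<exists>b\<in>C. orth_proj H a = orth_proj H b \<and> z = (1/2) *\<^sub>R (a + reflect H b))"
    (is "_ \<longleftrightarrow> ?R")
proof -
  have fib: "v \<in> (\<lambda>y. y + x) ` (H\<^sup>\<bottom>) \<longleftrightarrow> orth_proj H v = x" if "x \<in> H" for v x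
  proof -
    have "v \<in> (\<lambda>y. y + x) ` (H\<^sup>\<bottom>) \<longleftrightarrow> v - x \<in> H\<^sup>\<bottom>"
    proof
      assume "v - x \<in> H\<^sup>\<bottom>"
      then show "v \<in> (\<lambda>y. y + x) ` (H\<^sup>\<bottom>)" by (rule rev_image_eqI) simp
    qed (elim imageE, simp)
    also have "\<dots> \<longleftrightarrow> orth_proj H v = x"
      using orth_proj_unique[OF H that] diff_orth_proj_in[OF H] by blast
    finally show ?thesis .
  qed
  have "z \<in> fiber_sym H C \<longleftrightarrow> (\<exists>x\<in>H. \<exists>a c. a \<in> C \<and> orth_proj H a = x \<and>
      c \<in> reflect H ` C \<and> orth_proj H c = x \<and> z = (1/2) *\<^sub>R a + (1/2) *\<^sub>R c)"
    unfolding fiber_sym_def msum_def UN_iff mem_Collect_eq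
  proof (rule bex_cong[OF refl])
    fix x assume "x \<in> H"
    note fib = fib[OF this]
    show "(\<exists>xa y. z = xa + y \<and> xa \<in> (\<lambda>v. (1/2) *\<^sub>R v) ` (C \<inter> (\<lambda>y. y + x) ` (H\<^sup>\<bottom>))
         \<and> y \<in> (\<lambda>v. (1/2) *\<^sub>R v) ` (reflect H ` C \<inter> (\<lambda>y. y + x) ` (H\<^sup>\<bottom>))) \<longleftrightarrow>
      (\<exists>a c. a \<in> C \<and> orth_proj H a = x \<and> c \<in> reflect H ` C \<and> orth_proj H c = x
         \<and> z = (1/2) *\<^sub>R a + (1/2) *\<^sub>R c)"
      unfolding image_iff[of _ "\<lambda>v. (1/2) *\<^sub>R v"] Bex_def Int_iff fib by fast
  qed
  also have "\<dots> \<longleftrightarrow> ?R"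
  proof
    assume ?R
    then show "\<exists>x\<in>H. \<exists>a c. a \<in> C \<and> orth_proj H a = x \<and>
      c \<in> reflect H ` C \<and> orth_proj H c = x \<and> z = (1/2) *\<^sub>R a + (1/2) *\<^sub>R c"
      using orth_proj_in[OF H] orth_proj_reflect[OF H]
      by (metis image_eqI scaleR_right_distrib)
  next
    assume "\<exists>x\<in>H. \<exists>a c. a \<in> C \<and> orth_proj H a = x \<and>
      c \<in> reflect H ` C \<and> orth_proj H c = x \<and> z = (1/2) *\<^sub>R a + (1/2) *\<^sub>R c"
    then obtain a b where "a \<in> C" "b \<in> C" "orth_proj H (reflect H b) = orth_proj H a"
        "z = (1/2) *\<^sub>R a + (1/2) *\<^sub>R reflect H b"
      by blast
    then show ?R by (metis orth_proj_reflect[OF H] scaleR_right_distrib)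
  qed
  finally show ?thesis .
qed

lemma fiber_sym_mono:
  fixes H :: "'a::euclidean_space set"
  assumes "subspace H" "C \<subseteq> D"
  shows "fiber_sym H C \<subseteq> fiber_sym H D"
  using assms(2) by (auto simp: mem_fiber_sym_iff[OF assms(1)] simp del: scaleR_right_distrib) blast

lemma fiber_sym_nonempty:
  fixes H :: "'a::euclidean_space set"
  assumes "subspace H" "C \<noteq> {}"
  shows "fiber_sym H C \<noteq> {}"
proof -
  obtain a where "a \<in> C" using assms(2) by blast
  then have "(1/2) *\<^sub>R (a + reflect H a) \<in> fiber_sym H C"
    unfolding mem_fiber_sym_iff[OF assms(1)] by blast
  then show ?thesis by blast
qed

lemma compact_fiber_sym:
  fixes H :: "'a::euclidean_space set"
  assumes H: "subspace H" and C: "compact C"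
  shows "compact (fiber_sym H C)"
proof -
  \<comment> \<open>\<open>D\<close> is the fiber product of \<open>C\<close> with itself over
    \<open>H\<close>; the symmetrization is its image under a linear map.\<close>
  define D where "D = {p \<in> C \<times> C. orth_proj H (fst p) = orth_proj H (snd p)}"
  have cP: "continuous_on S (orth_proj H)" and cR: "continuous_on S (reflect H)" for S
    by (simp_all add: linear_continuous_on linear_conv_bounded_linear[symmetric] linear_orth_proj linear_reflect H)
  have "D = (C \<times> C) \<inter> {p. orth_proj H (fst p) = orth_proj H (snd p)}"
    by (auto simp: D_def)
  moreover have "closed {p :: 'a \<times> 'a. orth_proj H (fst p) = orth_proj H (snd p)}"
    by (intro closed_Collect_eq continuous_on_compose2[OF cP] continuous_intros) auto
  ultimately have "compact D" using C by (simp add: compact_Int_closed compact_Times)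
  moreover have "continuous_on D (\<lambda>p. (1/2) *\<^sub>R (fst p + reflect H (snd p)))"
    by (intro continuous_on_compose2[OF cR] continuous_intros) auto
  ultimately have "compact ((\<lambda>p. (1/2) *\<^sub>R (fst p + reflect H (snd p))) ` D)"
    by (intro compact_continuous_image)
  moreover have "fiber_sym H C = (\<lambda>p. (1/2) *\<^sub>R (fst p + reflect H (snd p))) ` D"
  proof (rule set_eqI)
    show "z \<in> fiber_sym H C \<longleftrightarrow> z \<in> (\<lambda>p. (1/2) *\<^sub>R (fst p + reflect H (snd p))) ` D" for z
      unfolding mem_fiber_sym_iff[OF H] D_def image_iff by auto
  qed
  ultimately show ?thesis by simp
qed

text \<open>The pairs with equal projection form a convex set, and averaging is linear in the
  pair.\<close>

lemma convex_fiber_sym: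
  fixes H :: "'a::euclidean_space set"
  assumes H: "subspace H" and C: "convex C"
  shows "convex (fiber_sym H C)"
proof (rule convexI)
  fix y z and u v :: real
  assume y: "y \<in> fiber_sym H C" and z: "z \<in> fiber_sym H C" and uv: "0 \<le> u" "0 \<le> v" "u + v = 1"
  from y obtain a b where ab: "a \<in> C" "b \<in> C" "orth_proj H a = orth_proj H b"
      "y = (1/2) *\<^sub>R (a + reflect H b)"
    by (auto simp: mem_fiber_sym_iff[OF H])
  from z obtain a' b' where ab': "a' \<in> C" "b' \<in> C" "orth_proj H a' = orth_proj H b'"
      "z = (1/2) *\<^sub>R (a' + reflect H b')"
    by (auto simp: mem_fiber_sym_iff[OF H])
  note lin = linear_add[OF linear_orth_proj[OF H]] linear_scale[OF linear_orth_proj[OF H]]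
    linear_add[OF linear_reflect[OF H]] linear_scale[OF linear_reflect[OF H]]
  have "u *\<^sub>R a + v *\<^sub>R a' \<in> C" "u *\<^sub>R b + v *\<^sub>R b' \<in> C"
    using C ab ab' uv by (auto intro: convexD)
  moreover have "orth_proj H (u *\<^sub>R a + v *\<^sub>R a') = orth_proj H (u *\<^sub>R b + v *\<^sub>R b')"
    by (simp add: lin ab ab')
  moreover have "u *\<^sub>R y + v *\<^sub>R z =
      (1/2) *\<^sub>R ((u *\<^sub>R a + v *\<^sub>R a') + reflect H (u *\<^sub>R b + v *\<^sub>R b'))"
    by (simp add: lin ab ab' algebra_simps)
  ultimately show "u *\<^sub>R y + v *\<^sub>R z \<in> fiber_sym H C"
    unfolding mem_fiber_sym_iff[OF H] by blast
qed

text \<open>One half of Hausdorff closeness. The halves are kept apart because symmetrization is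
  controlled only in the direction from the iterates into an invariant body.\<close>

definition nbhd_within :: "real \<Rightarrow> 'a::metric_space set \<Rightarrow> 'a set \<Rightarrow> bool" where
  "nbhd_within e A B \<longleftrightarrow> (\<forall>a\<in>A. \<exists>b\<in>B. dist a b \<le> e)"

text \<open>Average points of \<open>L\<close> near \<open>a\<close> and \<open>b\<close>. These
  need not share a fiber, so convexity and invariance place their average in \<open>L\<close>;
  reflections preserve norms, so the error \<open>e\<close> does not grow.\<close>

lemma fiber_sym_nbhd_within:
  fixes H :: "'a::euclidean_space set"
  assumes H: "subspace H" and L: "convex L" "reflect H ` L = L" and C: "nbhd_within e C L"
  shows "nbhd_within e (fiber_sym H C) L"
  unfolding nbhd_within_def
proof
  fix z assume "z \<in> fiber_sym H C"
  then obtain a b where ab: "a \<in> C" "b \<in> C" and z: "z = (1/2) *\<^sub>R (a + reflect H b)"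
    by (auto simp: mem_fiber_sym_iff[OF H])
  obtain l l' where l: "l \<in> L" "dist a l \<le> e" and l': "l' \<in> L" "dist b l' \<le> e"
    using C ab unfolding nbhd_within_def by meson
  have "reflect H l' \<in> L" using L(2) l'(1) by blast
  then have "(1/2) *\<^sub>R l + (1/2) *\<^sub>R reflect H l' \<in> L"
    using l L(1) by (auto intro: convexD)
  moreover have "dist z ((1/2) *\<^sub>R l + (1/2) *\<^sub>R reflect H l') \<le> e"
  proof -
    have "z - ((1/2) *\<^sub>R l + (1/2) *\<^sub>R reflect H l') = (1/2) *\<^sub>R ((a - l) + reflect H (b - l'))"
      by (simp add: z linear_diff[OF linear_reflect[OF H]] algebra_simps)
    then have "dist z ((1/2) *\<^sub>R l + (1/2) *\<^sub>R reflect H l') = norm ((a - l) + reflect H (b - l')) / 2"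
      by (simp add: dist_norm)
    also have "\<dots> \<le> (norm (a - l) + norm (reflect H (b - l'))) / 2"
      by (simp add: norm_triangle_ineq)
    also have "\<dots> \<le> e" using l l' by (simp add: norm_reflect[OF H] dist_norm)
    finally show ?thesis .
  qed
  ultimately show "\<exists>l\<in>L. dist z l \<le> e" by blast
qed

lemma fiber_sym_subset_cball:
  fixes H :: "'a::euclidean_space set"
  assumes H: "subspace H" and C: "C \<subseteq> cball 0 r"
  shows "fiber_sym H C \<subseteq> cball 0 r"
proof -
  have "reflect H 0 = 0" by (rule linear_0[OF linear_reflect[OF H]])
  \<comment> \<open>With \<open>{0}\<close> as the invariant convex set, the neighbourhood of radius
    \<open>r\<close> is the ball itself.\<close>
  then have "nbhd_within r (fiber_sym H C) {0}"
    using C by (intro fiber_sym_nbhd_within[OF H]) (auto simp: nbhd_within_def dist_commute subset_iff)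
  then show ?thesis by (auto simp: nbhd_within_def)
qed

text \<open>Only upper semicontinuity holds: tilting a segment orthogonal to \<open>H\<close> collapses
  its fibers to points.\<close>

lemma fiber_sym_upper_semicontinuous:
  fixes H :: "'a::euclidean_space set"
  assumes H: "subspace H" and L: "compact L"
    and near: "\<And>e. e > 0 \<Longrightarrow> \<forall>\<^sub>F j in sequentially. nbhd_within e (X j) L"
    and lim: "\<And>e. e > 0 \<Longrightarrow> \<forall>\<^sub>F j in sequentially. nbhd_within e M (fiber_sym H (X j))"
  shows "M \<subseteq> fiber_sym H L"
proof
  fix z assume z: "z \<in> M"
  have "\<exists>l l'. l \<in> L \<and> l' \<in> L \<and> norm (orth_proj H (l - l')) \<le> e
      \<and> dist z ((1/2) *\<^sub>R (l + reflect H l')) \<le> e" if "e > 0" for e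
  proof -
    obtain B where B: "B > 0" "\<And>x. norm (orth_proj H x) \<le> B * norm x"
      using linear_bounded_pos[OF linear_orth_proj[OF H]] by blast
    \<comment> \<open>Two errors of size \<open>d\<close> arise both in the projection of
      \<open>l - l'\<close>, where they are magnified by at most \<open>B\<close>, and in the
      distance to \<open>z\<close>.\<close>
    define d where "d = min (e/2) (e / (2 * B))"
    have d: "d > 0" "2 * d \<le> e" "B * (2 * d) \<le> e"
      using that B(1) by (auto simp: d_def min_def field_simps)
    have "\<forall>\<^sub>F j in sequentially. nbhd_within d (X j) L \<and> nbhd_within d M (fiber_sym H (X j))"
      using near[OF d(1)] lim[OF d(1)] by (rule eventually_conj)
    then obtain j where j: "nbhd_within d (X j) L" "nbhd_within d M (fiber_sym H (X j))"
      using eventually_happens'[OF sequentially_bot] by blast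
    then obtain y where y: "y \<in> fiber_sym H (X j)" "dist z y \<le> d"
      using z unfolding nbhd_within_def by meson
    then obtain a b where ab: "a \<in> X j" "b \<in> X j" "orth_proj H a = orth_proj H b"
        "y = (1/2) *\<^sub>R (a + reflect H b)"
      by (auto simp: mem_fiber_sym_iff[OF H])
    obtain l l' where l: "l \<in> L" "dist a l \<le> d" and l': "l' \<in> L" "dist b l' \<le> d"
      using j(1) ab unfolding nbhd_within_def by meson
    have "orth_proj H (l - l') = orth_proj H ((b - l') - (a - l))"
      using ab(3) by (simp add: linear_diff[OF linear_orth_proj[OF H]])
    then have "norm (orth_proj H (l - l')) \<le> B * norm ((b - l') - (a - l))"
      using B(2) by metis
    also have "\<dots> \<le> B * (2 * d)"
      using B(1) l(2) l'(2) norm_triangle_ineq4[of "b - l'" "a - l"]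
      by (intro mult_left_mono) (auto simp: dist_norm)
    finally have 1: "norm (orth_proj H (l - l')) \<le> e" using d by simp
    have "y - (1/2) *\<^sub>R (l + reflect H l') = (1/2) *\<^sub>R ((a - l) + reflect H (b - l'))"
      by (simp add: ab(4) linear_diff[OF linear_reflect[OF H]] algebra_simps)
    then have "dist y ((1/2) *\<^sub>R (l + reflect H l')) = norm ((a - l) + reflect H (b - l')) / 2"
      by (simp add: dist_norm)
    also have "\<dots> \<le> (norm (a - l) + norm (reflect H (b - l'))) / 2"
      by (simp add: norm_triangle_ineq)
    also have "\<dots> \<le> d" using l l' by (simp add: norm_reflect[OF H] dist_norm)
    finally have "dist z ((1/2) *\<^sub>R (l + reflect H l')) \<le> e"
      using y(2) d(2) dist_triangle[of z "(1/2) *\<^sub>R (l + reflect H l')" y] by linarith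
    with 1 l l' show ?thesis by blast
  qed
  note approx = this
  \<comment> \<open>\<open>f\<close> measures how far a pair is from lying in one fiber and
    averaging to \<open>z\<close>. Its minimum over the compact \<open>L \<times> L\<close> is
    attained and at most every positive \<open>e\<close>, so an exact pair exists.\<close>
  define f where "f p = max (norm (orth_proj H (fst p - snd p)))
    (dist z ((1/2) *\<^sub>R (fst p + reflect H (snd p))))" for p
  have cP: "continuous_on S (orth_proj H)" and cR: "continuous_on S (reflect H)" for S
    by (simp_all add: linear_continuous_on linear_conv_bounded_linear[symmetric] linear_orth_proj linear_reflect H)
  have "continuous_on (L \<times> L) f"
    unfolding f_def
    by (intro continuous_on_max continuous_on_compose2[OF cP] continuous_on_compose2[OF cR]
        continuous_intros) auto
  moreover have "L \<times> L \<noteq> {}" using approx[of 1] by auto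
  ultimately obtain p where p: "p \<in> L \<times> L" "\<And>q. q \<in> L \<times> L \<Longrightarrow> f p \<le> f q"
    using continuous_attains_inf[OF compact_Times[OF L L]] by metis
  have "f p \<le> e" if "e > 0" for e
  proof -
    obtain l l' where "l \<in> L" "l' \<in> L" "norm (orth_proj H (l - l')) \<le> e"
      "dist z ((1/2) *\<^sub>R (l + reflect H l')) \<le> e" using approx \<open>e > 0\<close> by blast
    then have "f (l, l') \<le> e" by (simp add: f_def)
    then show ?thesis using p(2)[of "(l, l')"] \<open>l \<in> L\<close> \<open>l' \<in> L\<close> by simp
  qed
  then have "f p \<le> 0" by (rule field_le_epsilon) simp
  then have "norm (orth_proj H (fst p - snd p)) \<le> 0"
    and "dist z ((1/2) *\<^sub>R (fst p + reflect H (snd p))) \<le> 0"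
    unfolding f_def by (auto simp only: max.bounded_iff)
  then have "orth_proj H (fst p) = orth_proj H (snd p)" "z = (1/2) *\<^sub>R (fst p + reflect H (snd p))"
    by (simp_all add: linear_diff[OF linear_orth_proj[OF H]])
  then show "z \<in> fiber_sym H L" using p(1) unfolding mem_fiber_sym_iff[OF H] by (metis mem_Times_iff)
qed

section \<open>Bodies containing the boundary of their convex hull\<close>

text \<open>\<open>H\<^sup>\<bottom>\<close> has dimension at least two, so it properly contains the
  span of \<open>d\<close>.\<close>

lemma exists_orthogonal_in_orthogonal_comp:
  fixes H :: "'a::euclidean_space set"
  assumes H: "subspace H" "dim H + 2 \<le> DIM('a)" and d: "d \<in> H\<^sup>\<bottom>"
  obtains e where "e \<in> H\<^sup>\<bottom>" "e \<noteq> 0" "e \<bullet> d = 0"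
proof -
  have "dim {y \<in> UNIV. \<forall>x\<in>H. orthogonal x y} + dim H = dim (UNIV :: 'a set)"
    by (rule dim_subspace_orthogonal_to_vectors) (use H in auto)
  then have "dim (H\<^sup>\<bottom>) \<ge> 2" using H(2) by (simp add: orthogonal_comp_def)
  moreover have "dim (span {d}) \<le> 1" by simp
  moreover have sub: "span (H\<^sup>\<bottom>) = H\<^sup>\<bottom>" by (simp add: span_eq_iff subspace_orthogonal_comp)
  moreover have "span {d} \<subseteq> H\<^sup>\<bottom>" by (simp add: span_minimal subspace_orthogonal_comp d)
  ultimately have "span {d} \<subset> span (H\<^sup>\<bottom>)" by (metis dim_span not_less_eq_eq one_add_one
        order_trans plus_1_eq_Suc psubsetI le_antisym numeral_2_eq_2 One_nat_def)
  then obtain e where "e \<noteq> 0" "e \<in> span (H\<^sup>\<bottom>)" "\<And>y. y \<in> span {d} \<Longrightarrow> orthogonal e y"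
    using orthogonal_to_subspace_exists_gen by blast
  then show thesis using that[of e] sub by (auto simp: orthogonal_def span_base)
qed

lemma interior_shift:
  fixes C :: "'a::real_normed_vector set"
  assumes "x \<in> interior C"
  obtains t where "t > 0" "\<And>s. 0 \<le> s \<Longrightarrow> s \<le> t \<Longrightarrow> x + s *\<^sub>R v \<in> C"
proof -
  obtain r where r: "r > 0" "ball x r \<subseteq> C" using assms by (auto simp: mem_interior)
  \<comment> \<open>The summand \<open>1\<close> keeps \<open>t\<close> positive when
    \<open>v = 0\<close>.\<close>
  define t where "t = r / (2 * (norm v + 1))"
  have t0: "t > 0" using r by (auto simp: t_def intro!: divide_pos_pos add_nonneg_pos)
  have "x + s *\<^sub>R v \<in> C" if "0 \<le> s" "s \<le> t" for s
  proof -
    have "s * norm v \<le> t * (norm v + 1)" using that t0 by (intro mult_mono) auto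
    also have "\<dots> = r / 2" unfolding t_def using norm_ge_zero[of v] by (simp add: field_simps add_nonneg_eq_0_iff)
    finally have "dist x (x + s *\<^sub>R v) < r" using that r(1) by (simp add: dist_norm)
    then show ?thesis using r(2) by auto
  qed
  with t0 that show thesis by blast
qed

text \<open>Among the chords parallel to \<open>d\<close> in the given fiber, take one that is extreme in a
  direction \<open>e\<close> of the fiber orthogonal to \<open>d\<close>, and push it along \<open>-d\<close> as far as possible.\<close>

lemma parallel_chord_in_frontier:
  fixes C :: "'a::euclidean_space set"
  assumes C: "compact C" "convex C" and H: "subspace H" "dim H + 2 \<le> DIM('a)"
    and b: "b \<in> C" "b + d \<in> C" and d: "d \<in> H\<^sup>\<bottom>"
  obtains p where "p \<in> frontier C" "p + d \<in> frontier C" "p - b \<in> H\<^sup>\<bottom>"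
proof -
  note V = subspace_orthogonal_comp[of H]
  obtain e where e: "e \<in> H\<^sup>\<bottom>" "e \<noteq> 0" "e \<bullet> d = 0"
    using exists_orthogonal_in_orthogonal_comp[OF H d] by blast
  \<comment> \<open>\<open>D\<close> lists the translates of the chord inside \<open>C\<close> and
    the fiber of \<open>b\<close> by their initial points.\<close>
  define D where "D = {p. p \<in> C \<and> p + d \<in> C \<and> p - b \<in> H\<^sup>\<bottom>}"
  have "D = C \<inter> ((+) (- d) ` C \<inter> (+) b ` (H\<^sup>\<bottom>))"
    by (force simp: D_def image_iff algebra_simps)
  moreover have "closed ((+) (- d) ` C)" "closed ((+) b ` (H\<^sup>\<bottom>))"
    by (rule closed_translation, rule compact_imp_closed[OF C(1)])
      (rule closed_translation, rule closed_subspace[OF V])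
  ultimately have D: "compact D"
    using C(1) by (metis compact_Int_closed closed_Int)
  have "b \<in> D" using b V by (simp add: D_def subspace_0)
  then have "D \<noteq> {}" by blast
  then obtain p0 where p0: "p0 \<in> D" "\<And>q. q \<in> D \<Longrightarrow> q \<bullet> e \<le> p0 \<bullet> e"
    using continuous_attains_sup[OF D, of "\<lambda>q. q \<bullet> e"] continuous_on_inner[OF continuous_on_id continuous_on_const]
    by blast
  define M where "M = D \<inter> {q. q \<bullet> e = p0 \<bullet> e}"
  have "compact M" unfolding M_def
    by (intro compact_Int_closed D closed_Collect_eq continuous_intros)
  moreover have "M \<noteq> {}" using p0(1) by (auto simp: M_def)
  ultimately obtain p where p: "p \<in> M" "\<And>q. q \<in> M \<Longrightarrow> p \<bullet> d \<le> q \<bullet> d"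
    using continuous_attains_inf[of M "\<lambda>q. q \<bullet> d"] continuous_on_inner[OF continuous_on_id continuous_on_const]
    by blast
  have pD: "p \<in> C" "p + d \<in> C" "p - b \<in> H\<^sup>\<bottom>" and pe: "p \<bullet> e = p0 \<bullet> e"
    using p(1) by (auto simp: M_def D_def)
  have inV: "p + s *\<^sub>R v - b \<in> H\<^sup>\<bottom>" if "v \<in> H\<^sup>\<bottom>" for s v
  proof -
    have "(p - b) + s *\<^sub>R v \<in> H\<^sup>\<bottom>" using that pD(3) V by (simp add: subspace_add subspace_scale)
    then show ?thesis by (simp add: algebra_simps)
  qed
  \<comment> \<open>If both endpoints were interior, the chord could be moved along
    \<open>e\<close>. Sliding along \<open>d\<close> does not change the inner product with
    \<open>e\<close>, so this contradicts maximality over \<open>D\<close>.\<close>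
  have both: "False" if s: "p + s *\<^sub>R d \<in> interior C" "p + s *\<^sub>R d + d \<in> interior C" for s
  proof -
    obtain t1 where t1: "t1 > 0" "\<And>s'. 0 \<le> s' \<Longrightarrow> s' \<le> t1 \<Longrightarrow> (p + s *\<^sub>R d) + s' *\<^sub>R e \<in> C"
      using interior_shift[OF s(1)] by blast
    obtain t2 where t2: "t2 > 0" "\<And>s'. 0 \<le> s' \<Longrightarrow> s' \<le> t2 \<Longrightarrow> (p + s *\<^sub>R d + d) + s' *\<^sub>R e \<in> C"
      using interior_shift[OF s(2)] by blast
    define t where "t = min t1 t2"
    have t: "t > 0" "t \<le> t1" "t \<le> t2" using t1 t2 by (auto simp: t_def)
    define q where "q = p + s *\<^sub>R d + t *\<^sub>R e"
    have "q + d = (p + s *\<^sub>R d + d) + t *\<^sub>R e" by (simp add: q_def algebra_simps)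
    then have "q + d \<in> C" using t t2(2) by (metis less_imp_le)
    moreover have "q \<in> C" using t t1(2) by (simp add: q_def)
    moreover have "(p + s *\<^sub>R d - b) + t *\<^sub>R e \<in> H\<^sup>\<bottom>"
      using inV[OF d] e(1) V by (simp add: subspace_add subspace_scale)
    then have "q - b \<in> H\<^sup>\<bottom>" by (simp add: q_def algebra_simps)
    ultimately have "q \<in> D" by (simp add: D_def)
    then have "q \<bullet> e \<le> p \<bullet> e" using p0(2) pe by simp
    moreover have "q \<bullet> e = p \<bullet> e + t * (e \<bullet> e)"
      using e(3) by (simp add: q_def algebra_simps inner_commute)
    moreover have "t * (e \<bullet> e) > 0" using t(1) e(2) by simp
    ultimately show False by linarith
  qed
  \<comment> \<open>If the terminal point is interior, so is the whole chord except perhaps its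
    initial point; a small slide along \<open>d\<close> then makes both endpoints interior.\<close>
  have 2: "p + d \<notin> interior C"
  proof
    assume int: "p + d \<in> interior C"
    obtain s0 where s0: "s0 > 0" "\<And>s. 0 \<le> s \<Longrightarrow> s \<le> s0 \<Longrightarrow> (p + d) + s *\<^sub>R d \<in> interior C"
      using interior_shift[of "p + d" "interior C" d] int by (auto simp: interior_open)
    define s where "s = min s0 1"
    have s: "0 < s" "s \<le> s0" "s \<le> 1" using s0(1) by (auto simp: s_def)
    have "p - s *\<^sub>R (p - (p + d)) \<in> interior C"
      by (rule mem_interior_convex_shrink[OF C(2) int pD(1) s(1,3)])
    then have "p + s *\<^sub>R d \<in> interior C" by simp
    moreover have "p + s *\<^sub>R d + d \<in> interior C" using s0(2)[of s] s by (simp add: algebra_simps)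
    ultimately show False by (rule both)
  qed
  \<comment> \<open>An interior initial point permits a slide along \<open>- d\<close> that stays in
    \<open>M\<close>, against minimality of \<open>p \<bullet> d\<close>. For \<open>d = 0\<close>
    the endpoints coincide and \<open>both\<close> applies directly.\<close>
  have 1: "p \<notin> interior C"
  proof
    assume int: "p \<in> interior C"
    show False
    proof (cases "d = 0")
      case True
      then show False using both[of 0] int by simp
    next
      case False
      obtain t where t: "t > 0" "\<And>s. 0 \<le> s \<Longrightarrow> s \<le> t \<Longrightarrow> p + s *\<^sub>R (- d) \<in> C"
        using interior_shift[OF int] by blast
      define s where "s = min t 1"
      have s: "0 < s" "s \<le> t" "s \<le> 1" using t(1) by (auto simp: s_def)
      define q where "q = p + (- s) *\<^sub>R d"
      have "q \<in> C" using t(2)[of s] s by (simp add: q_def)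
      moreover have "s *\<^sub>R p + (1 - s) *\<^sub>R (p + d) \<in> C"
        using s pD C(2) by (intro convexD) auto
      then have "q + d \<in> C" by (simp add: q_def algebra_simps)
      moreover have "q - b \<in> H\<^sup>\<bottom>" unfolding q_def by (rule inV[OF d])
      moreover have "q \<bullet> e = p0 \<bullet> e" using e(3) pe by (simp add: q_def inner_diff_left inner_commute[of d])
      ultimately have "q \<in> M" by (simp add: M_def D_def)
      then have "p \<bullet> d \<le> q \<bullet> d" by (rule p(2))
      then have "s * (d \<bullet> d) \<le> 0" by (simp add: q_def inner_diff_left)
      moreover have "s * (d \<bullet> d) > 0" using s(1) False by simp
      ultimately show False by linarith
    qed
  qed
  have "p \<in> frontier C" "p + d \<in> frontier C"
    using 1 2 pD closure_subset by (auto simp: frontier_def)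
  then show thesis using that pD(3) by blast
qed

text \<open>Since \<open>a + reflect H b\<close> equals
  \<open>(a - b) + 2 *\<^sub>R orth_proj H b\<close>, the averaged point depends only on the chord
  vector and the fiber. Translating the chord until both endpoints lie on the frontier produces the
  same point from \<open>K\<close>.\<close>

lemma fiber_sym_eq_fiber_sym_convex_hull:
  fixes K :: "'a::euclidean_space set"
  assumes K: "compact K" "frontier (convex hull K) \<subseteq> K" and H: "subspace H" "dim H + 2 \<le> DIM('a)"
  shows "fiber_sym H K = fiber_sym H (convex hull K)"
proof
  show "fiber_sym H K \<subseteq> fiber_sym H (convex hull K)"
    by (rule fiber_sym_mono[OF H(1) hull_subset])
  show "fiber_sym H (convex hull K) \<subseteq> fiber_sym H K"
  proof
    fix z assume "z \<in> fiber_sym H (convex hull K)"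
    then obtain a b where ab: "a \<in> convex hull K" "b \<in> convex hull K" "orth_proj H a = orth_proj H b"
      "z = (1/2) *\<^sub>R (a + reflect H b)"
      by (auto simp: mem_fiber_sym_iff[OF H(1)])
    have "a - b \<in> H\<^sup>\<bottom>" using ab(3) orth_proj_eq_iff[OF H(1)] by blast
    moreover have "b + (a - b) \<in> convex hull K" using ab(1) by simp
    ultimately obtain p where p: "p \<in> frontier (convex hull K)" "p + (a - b) \<in> frontier (convex hull K)"
      "p - b \<in> H\<^sup>\<bottom>"
      using parallel_chord_in_frontier[OF compact_convex_hull[OF K(1)] convex_convex_hull H ab(2)] by blast
    have pb: "orth_proj H p = orth_proj H b" using p(3) orth_proj_eq_iff[OF H(1)] by blast
    have "orth_proj H (p + (a - b)) = orth_proj H p"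
      by (simp add: linear_add[OF linear_orth_proj[OF H(1)]] linear_diff[OF linear_orth_proj[OF H(1)]] ab(3))
    moreover have "z = (1/2) *\<^sub>R (p + (a - b) + reflect H p)"
      using pb by (simp add: ab(4) reflect_def)
    ultimately show "z \<in> fiber_sym H K"
      using p K(2) unfolding mem_fiber_sym_iff[OF H(1)] by blast
  qed
qed

section \<open>A Lyapunov functional\<close>

definition support_fun :: "'a::euclidean_space set \<Rightarrow> 'a \<Rightarrow> real" where
  "support_fun C u = (SUP x\<in>C. x \<bullet> u)"

lemma bdd_above_inner_image:
  assumes "compact C"
  shows "bdd_above ((\<lambda>x. x \<bullet> u) ` C)"
  using assms by (intro bounded_imp_bdd_above compact_imp_bounded compact_continuous_image continuous_intros)

lemma inner_le_support_fun:
  assumes "compact C" "x \<in> C"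
  shows "x \<bullet> u \<le> support_fun C u"
  unfolding support_fun_def using assms by (intro cSUP_upper bdd_above_inner_image)

lemma support_fun_leI:
  assumes "C \<noteq> {}" "\<And>x. x \<in> C \<Longrightarrow> x \<bullet> u \<le> c"
  shows "support_fun C u \<le> c"
  unfolding support_fun_def using assms by (intro cSUP_least) auto

lemma support_fun_nbhd_within:
  assumes "C \<noteq> {}" "compact D" "nbhd_within e C D"
  shows "support_fun C u \<le> support_fun D u + e * norm u"
proof (rule support_fun_leI[OF assms(1)])
  fix x assume "x \<in> C"
  then obtain y where y: "y \<in> D" "dist x y \<le> e" using assms(3) by (auto simp: nbhd_within_def)
  have "x \<bullet> u = y \<bullet> u + (x - y) \<bullet> u" by (simp add: inner_diff_left)
  also have "\<dots> \<le> support_fun D u + norm (x - y) * norm u"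
    using inner_le_support_fun[OF assms(2) y(1)] norm_cauchy_schwarz by (intro add_mono)
  also have "\<dots> \<le> support_fun D u + e * norm u"
    using y(2) by (simp add: dist_norm mult_right_mono)
  finally show "x \<bullet> u \<le> support_fun D u + e * norm u" .
qed

lemma support_fun_scaleR:
  assumes "compact C" "C \<noteq> {}" "c > 0"
  shows "support_fun C (c *\<^sub>R u) = c * support_fun C u"
proof (rule antisym)
  show "support_fun C (c *\<^sub>R u) \<le> c * support_fun C u"
    using assms by (intro support_fun_leI) (auto intro: mult_left_mono inner_le_support_fun)
  have "support_fun C u \<le> support_fun C (c *\<^sub>R u) / c"
    using assms inner_le_support_fun[OF assms(1), of _ "c *\<^sub>R u"]
    by (intro support_fun_leI) (auto simp: field_simps)
  then show "c * support_fun C u \<le> support_fun C (c *\<^sub>R u)"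
    using assms(3) by (simp add: field_simps)
qed

text \<open>A norm bound for \<open>C\<close> serves as a Lipschitz constant.\<close>

lemma continuous_on_support_fun:
  assumes "compact C" "C \<noteq> {}"
  shows "continuous_on S (support_fun C)"
proof -
  obtain B where B: "\<And>x. x \<in> C \<Longrightarrow> norm x \<le> B" "B > 0"
    using assms(1) compact_imp_bounded bounded_pos by metis
  have le: "support_fun C u \<le> support_fun C v + B * dist u v" for u v
  proof (rule support_fun_leI[OF assms(2)])
    fix x assume x: "x \<in> C"
    have "x \<bullet> u = x \<bullet> v + x \<bullet> (u - v)" by (simp add: inner_diff_right)
    also have "\<dots> \<le> support_fun C v + norm x * norm (u - v)"
      using inner_le_support_fun[OF assms(1) x] norm_cauchy_schwarz by (intro add_mono)
    also have "\<dots> \<le> support_fun C v + B * dist u v"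
      using B(1)[OF x] by (simp add: dist_norm mult_right_mono)
    finally show "x \<bullet> u \<le> support_fun C v + B * dist u v" .
  qed
  have "B-lipschitz_on S (support_fun C)"
  proof (rule lipschitz_onI)
    show "dist (support_fun C u) (support_fun C v) \<le> B * dist u v" for u v
      using le[of u v] le[of v u] by (simp add: dist_real_def dist_commute abs_le_iff)
  qed (use B in simp)
  then show ?thesis by (rule lipschitz_on_continuous_on)
qed

lemma subset_if_support_fun_le:
  assumes C: "compact C" and D: "compact D" "convex D" "D \<noteq> {}"
    and le: "\<And>u. support_fun C u \<le> support_fun D u"
  shows "C \<subseteq> D"
proof
  fix z assume z: "z \<in> C"
  show "z \<in> D"
  proof (rule ccontr)
    assume "z \<notin> D"
    then obtain a b where ab: "a \<bullet> z < b" "\<And>x. x \<in> D \<Longrightarrow> a \<bullet> x > b"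
      using separating_hyperplane_closed_point[OF D(2) compact_imp_closed[OF D(1)]] by blast
    \<comment> \<open>The separating functional is larger on \<open>D\<close> than at
      \<open>z\<close>, so the violated direction is \<open>- a\<close>.\<close>
    have "support_fun D (- a) \<le> - b"
      using ab(2) D(3) by (intro support_fun_leI) (auto simp: inner_commute less_imp_le)
    moreover have "- (a \<bullet> z) \<le> support_fun C (- a)"
      using inner_le_support_fun[OF C z, of "- a"] by (simp add: inner_commute)
    ultimately show False using le[of "- a"] ab(1) by simp
  qed
qed

text \<open>Self-adjointness of \<open>reflect H\<close> moves the reflection from the point
  \<open>b\<close> to the direction \<open>u\<close>.\<close>

lemma support_fun_fiber_sym_le:
  assumes H: "subspace H" and C: "compact C" "C \<noteq> {}"
  shows "support_fun (fiber_sym H C) u \<le> (support_fun C u + support_fun C (reflect H u)) / 2"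
proof (rule support_fun_leI[OF fiber_sym_nonempty[OF H C(2)]])
  fix z assume "z \<in> fiber_sym H C"
  then obtain a b where ab: "a \<in> C" "b \<in> C" "z = (1/2) *\<^sub>R (a + reflect H b)"
    by (auto simp: mem_fiber_sym_iff[OF H])
  have "z \<bullet> u = (a \<bullet> u + b \<bullet> reflect H u) / 2"
    by (simp add: ab(3) inner_add_left inner_reflect_left[OF H])
  also have "\<dots> \<le> (support_fun C u + support_fun C (reflect H u)) / 2"
    using inner_le_support_fun[OF C(1) ab(1), of u] inner_le_support_fun[OF C(1) ab(2), of "reflect H u"] by simp
  finally show "z \<bullet> u \<le> (support_fun C u + support_fun C (reflect H u)) / 2" .
qed

text \<open>The orthogonal group, encoded as bounded linear maps so that the operator norm supplies
  its topology.\<close>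

definition isometries :: "('a::euclidean_space \<Rightarrow>\<^sub>L 'a) set" where
  "isometries = {g. \<forall>x. norm (blinfun_apply g x) = norm x}"

lemma compact_isometries: "compact (isometries :: ('a::euclidean_space \<Rightarrow>\<^sub>L 'a) set)"
proof -
  have "norm g \<le> 1" if "g \<in> isometries" for g :: "'a \<Rightarrow>\<^sub>L 'a"
    using that by (intro norm_blinfun_bound) (auto simp: isometries_def)
  then have "bounded (isometries :: ('a \<Rightarrow>\<^sub>L 'a) set)" by (auto simp: bounded_iff)
  moreover have "closed (isometries :: ('a \<Rightarrow>\<^sub>L 'a) set)"
    unfolding isometries_def
    by (intro closed_Collect_all closed_Collect_eq continuous_intros)
  ultimately show ?thesis by (simp add: compact_eq_bounded_closed)
qed

lemma id_in_isometries: "id_blinfun \<in> isometries"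
  by (simp add: isometries_def)

lemma surj_isometry:
  fixes g :: "'a::euclidean_space \<Rightarrow>\<^sub>L 'a"
  assumes "g \<in> isometries"
  shows "surj (blinfun_apply g)"
proof -
  have lin: "linear (blinfun_apply g)" by (intro bounded_linear.linear blinfun.bounded_linear_right)
  have "inj (blinfun_apply g)"
    using assms by (auto simp: linear_injective_0[OF lin] isometries_def) (metis norm_eq_zero)
  then show ?thesis using linear_injective_imp_surjective[OF lin] by blast
qed

text \<open>Closure under left multiplication by reflections lets a maximum over the group absorb
  \<open>reflect H\<close>.\<close>

lemma reflect_compose_isometry:
  fixes H :: "'a::euclidean_space set"
  assumes H: "subspace H" and g: "g \<in> isometries"
  obtains g' where "g' \<in> isometries" "\<And>u. blinfun_apply g' u = reflect H (blinfun_apply g u)"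
proof -
  have bl: "bounded_linear (reflect H)"
    using linear_reflect[OF H] by (simp add: linear_conv_bounded_linear)
  have "blinfun_apply (Blinfun (reflect H) o\<^sub>L g) u = reflect H (blinfun_apply g u)" for u
    by (simp add: bounded_linear_Blinfun_apply[OF bl])
  moreover from this have "(Blinfun (reflect H) o\<^sub>L g) \<in> isometries"
    using g by (simp add: isometries_def norm_reflect[OF H])
  ultimately show thesis using that by blast
qed

text \<open>A neighbourhood of the origin: by positive homogeneity, support functions are determined
  by their values on it.\<close>

abbreviation unit_box :: "'a::euclidean_space set" where
  "unit_box \<equiv> cbox (- One) One"

definition exp_support :: "'a::euclidean_space set \<Rightarrow> 'a \<Rightarrow>\<^sub>L 'a \<Rightarrow> real" where
  "exp_support C g = integral unit_box (\<lambda>u. exp (support_fun C (blinfun_apply g u)))"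

text \<open>The maximum over the orthogonal group makes this functional invariant under reflections
  without any appeal to the invariance of Lebesgue measure; it is attained, so strict convexity
  and strict monotonicity of the integral are inherited.\<close>

definition lyapunov :: "'a::euclidean_space set \<Rightarrow> real" where
  "lyapunov C = (SUP g\<in>isometries. exp_support C g)"

lemma continuous_on_exp_support_integrand:
  fixes g :: "'a::euclidean_space \<Rightarrow>\<^sub>L 'a"
  assumes "compact C" "C \<noteq> {}"
  shows "continuous_on S (\<lambda>u. exp (support_fun C (blinfun_apply g u)))"
  by (intro continuous_intros continuous_on_compose2[OF continuous_on_support_fun[OF assms, of UNIV]]) auto

lemma integrable_exp_support_integrand:
  fixes g :: "'a::euclidean_space \<Rightarrow>\<^sub>L 'a"
  assumes "compact C" "C \<noteq> {}"
  shows "(\<lambda>u. exp (support_fun C (blinfun_apply g u))) integrable_on unit_box"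
  by (intro integrable_continuous continuous_on_exp_support_integrand assms)

lemma continuous_on_exp_support:
  fixes C :: "'a::euclidean_space set"
  assumes "compact C" "C \<noteq> {}"
  shows "continuous_on S (exp_support C)"
proof -
  have "continuous_on (S \<times> unit_box) (\<lambda>(g, u). exp (support_fun C (blinfun_apply g u)))"
    unfolding case_prod_beta
    by (intro continuous_intros continuous_on_compose2[OF continuous_on_support_fun[OF assms, of UNIV]]) auto
  from integral_continuous_on_param[OF this] show ?thesis
    by (simp add: exp_support_def[abs_def])
qed

lemma exp_support_le_lyapunov:
  fixes C :: "'a::euclidean_space set"
  assumes "compact C" "C \<noteq> {}" "g \<in> isometries"
  shows "exp_support C g \<le> lyapunov C"
  unfolding lyapunov_def using assms
  by (intro cSUP_upper bounded_imp_bdd_above compact_imp_bounded compact_continuous_image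
      continuous_on_exp_support compact_isometries)

lemma lyapunov_attained:
  fixes C :: "'a::euclidean_space set"
  assumes "compact C" "C \<noteq> {}"
  obtains g where "g \<in> isometries" "lyapunov C = exp_support C g"
proof -
  have "(isometries :: ('a \<Rightarrow>\<^sub>L 'a) set) \<noteq> {}" using id_in_isometries by blast
  then obtain g where g: "g \<in> (isometries :: ('a \<Rightarrow>\<^sub>L 'a) set)"
      "\<And>g'. g' \<in> isometries \<Longrightarrow> exp_support C g' \<le> exp_support C g"
    using continuous_attains_sup[OF compact_isometries _ continuous_on_exp_support[OF assms]] by metis
  moreover have "lyapunov C \<le> exp_support C g"
    unfolding lyapunov_def using g by (intro cSUP_least) auto
  ultimately show thesis using that exp_support_le_lyapunov[OF assms] by force
qed

lemma lyapunov_nonneg: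
  assumes "compact C" "C \<noteq> {}"
  shows "0 \<le> lyapunov C"
proof -
  obtain g where "lyapunov C = exp_support C g" using lyapunov_attained[OF assms] by blast
  then show ?thesis unfolding exp_support_def
    by (simp add: integral_nonneg integrable_exp_support_integrand[OF assms])
qed

text \<open>The gap is half the square of \<open>exp (a/2) - exp (b/2)\<close>, which gives
  convexity and its equality case at once.\<close>

lemma exp_midpoint_le: "exp ((a + b) / 2) \<le> (exp a + exp b) / (2::real)"
  and exp_midpoint_eq: "exp ((a + b) / 2) = (exp a + exp b) / (2::real) \<Longrightarrow> a = b"
proof -
  have "exp ((a + b) / 2) = exp (a/2) * exp (b/2)" by (simp add: exp_add[symmetric] add_divide_distrib)
  moreover have "exp a = exp (a/2) ^ 2" "exp b = exp (b/2) ^ 2"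
    by (simp_all add: exp_double[symmetric])
  ultimately have eq: "(exp a + exp b) / 2 - exp ((a + b) / 2) = (exp (a/2) - exp (b/2))\<^sup>2 / 2"
    by (simp add: power2_eq_square algebra_simps add_divide_distrib diff_divide_distrib)
  then show "exp ((a + b) / 2) \<le> (exp a + exp b) / 2"
    using zero_le_power2[of "exp (a/2) - exp (b/2)"] by linarith
  show "a = b" if "exp ((a + b) / 2) = (exp a + exp b) / 2"
    using eq that by simp
qed

text \<open>Take \<open>g\<close> maximal for \<open>C\<close>. Its integrand is at most the mean of
  the integrands of \<open>D\<close> at the isometries \<open>g\<close> and \<open>R\<close> after
  \<open>g\<close>, whose integrals are bounded by \<open>lyapunov D\<close>. \<open>R\<close> stays
  abstract to cover both reflections (symmetrization) and \<open>id\<close> (inclusion).\<close>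

lemma lyapunov_le_and_rigid:
  fixes C D :: "'a::euclidean_space set"
  assumes C: "compact C" "C \<noteq> {}" and D: "compact D" "D \<noteq> {}"
    and R: "\<And>g. g \<in> isometries \<Longrightarrow> \<exists>g'\<in>isometries. \<forall>u. blinfun_apply g' u = R (blinfun_apply g u)"
    and le: "\<And>u. support_fun C u \<le> (support_fun D u + support_fun D (R u)) / 2"
  shows "lyapunov C \<le> lyapunov D"
    and "lyapunov C = lyapunov D \<Longrightarrow> support_fun C = support_fun D \<and> (\<forall>u. support_fun D (R u) = support_fun D u)"
proof -
  obtain g where g: "g \<in> isometries" "lyapunov C = exp_support C g"
    using lyapunov_attained[OF C] by blast
  obtain g' where g': "g' \<in> isometries" "\<And>u. blinfun_apply g' u = R (blinfun_apply g u)"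
    using R[OF g(1)] by blast
  define f where "f u = exp (support_fun C (blinfun_apply g u))" for u
  define k where "k u = (exp (support_fun D (blinfun_apply g u)) + exp (support_fun D (blinfun_apply g' u))) / 2" for u
  have mid: "f u \<le> exp ((support_fun D (blinfun_apply g u) + support_fun D (blinfun_apply g' u)) / 2)" for u
    using le[of "blinfun_apply g u"] by (simp add: f_def g'(2))
  have fk: "f u \<le> k u" for u
    using mid[of u] exp_midpoint_le unfolding k_def by (rule order_trans)
  note int = integrable_exp_support_integrand
  have if': "f integrable_on unit_box" unfolding f_def by (rule int[OF C])
  have ik: "k integrable_on unit_box" unfolding k_def
    by (intro integrable_on_divide integrable_add int D)
  have "integral unit_box k = (exp_support D g + exp_support D g') / 2"
    unfolding k_def exp_support_def
    by (simp add: integral_add int[OF D])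
  also have "\<dots> \<le> lyapunov D"
    using exp_support_le_lyapunov[OF D g(1)] exp_support_le_lyapunov[OF D g'(1)] by simp
  finally have kD: "integral unit_box k \<le> lyapunov D" .
  have fC: "integral unit_box f = lyapunov C" by (simp add: g(2) exp_support_def f_def[abs_def])
  have "integral unit_box f \<le> integral unit_box k"
    by (intro integral_le if' ik fk)
  with kD fC show "lyapunov C \<le> lyapunov D" by simp
  assume eq: "lyapunov C = lyapunov D"
  then have "integral unit_box (\<lambda>u. k u - f u) = 0"
    using \<open>integral unit_box f \<le> integral unit_box k\<close> kD fC by (simp add: integral_diff ik if')
  then have 0: "((\<lambda>u. k u - f u) has_integral 0) unit_box"
    using integrable_diff[OF ik if'] by (metis has_integral_integrable_integral)
  \<comment> \<open>A continuous nonnegative function with integral zero vanishes, so the pointwise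
    inequality is an equality on the box.\<close>
  have cont: "continuous_on unit_box (\<lambda>u. k u - f u)"
    unfolding k_def f_def
    by (intro continuous_on_diff continuous_on_divide continuous_on_add continuous_on_const
        continuous_on_exp_support_integrand C D) simp
  have "box (- One) (One :: 'a) \<noteq> {}" by (simp add: box_ne_empty)
  from has_integral_0_cbox_imp_0[OF cont _ 0 this] fk
  have kf: "k u = f u" if "u \<in> unit_box" for u using that by force
  have eqs: "support_fun C (blinfun_apply g u) = support_fun D (blinfun_apply g u)
      \<and> support_fun D (R (blinfun_apply g u)) = support_fun D (blinfun_apply g u)"
    if "u \<in> unit_box" for u
  proof -
    \<comment> \<open>The exponential of the mean is squeezed between \<open>f u\<close> and
      \<open>k u\<close>. Strict convexity equates the two values for \<open>D\<close>, and then
      \<open>f u = k u\<close> gives the value for \<open>C\<close>.\<close>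
    have "exp ((support_fun D (blinfun_apply g u) + support_fun D (blinfun_apply g' u)) / 2) \<le> k u"
      unfolding k_def by (rule exp_midpoint_le)
    then have "exp ((support_fun D (blinfun_apply g u) + support_fun D (blinfun_apply g' u)) / 2) = k u"
      using mid[of u] kf[OF that] by linarith
    then have *: "support_fun D (blinfun_apply g u) = support_fun D (blinfun_apply g' u)"
      unfolding k_def by (rule exp_midpoint_eq)
    then have "exp (support_fun C (blinfun_apply g u)) = exp (support_fun D (blinfun_apply g u))"
      using kf[OF that] by (simp add: k_def f_def)
    with * show ?thesis by (simp add: g'(2))
  qed
  have "support_fun C v = support_fun D v \<and> support_fun D (R v) = support_fun D v" for v
  proof -
    obtain u where u: "v = blinfun_apply g u" using surj_isometry[OF g(1)] by blast
    \<comment> \<open>Scaling by \<open>c\<close> brings \<open>u\<close> into the box because the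
      norm drops to at most one; homogeneity undoes it.\<close>
    define c where "c = 1 / (norm u + 1)"
    have c: "c > 0" by (auto simp: c_def intro!: divide_pos_pos add_nonneg_pos)
    have "norm (c *\<^sub>R u) \<le> 1" by (simp add: c_def add_nonneg_pos)
    then have "\<bar>(c *\<^sub>R u) \<bullet> i\<bar> \<le> 1" if "i \<in> Basis" for i
      using Basis_le_norm[OF that, of "c *\<^sub>R u"] by linarith
    then have "c *\<^sub>R u \<in> unit_box" by (auto simp: mem_box abs_le_iff)
    moreover have "R (blinfun_apply g (c *\<^sub>R u)) = c *\<^sub>R R v"
      by (metis g'(2) blinfun.scaleR_right u)
    ultimately show ?thesis
      using eqs[of "c *\<^sub>R u"] c
      by (simp add: blinfun.scaleR_right u[symmetric] support_fun_scaleR C D)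
  qed
  then show "support_fun C = support_fun D \<and> (\<forall>u. support_fun D (R u) = support_fun D u)" by blast
qed

lemma lyapunov_fiber_sym_le:
  fixes C :: "'a::euclidean_space set"
  assumes H: "subspace H" and C: "compact C" "C \<noteq> {}"
  shows "lyapunov (fiber_sym H C) \<le> lyapunov C"
proof (rule lyapunov_le_and_rigid(1)[of _ _ "reflect H"])
  show "\<exists>g'\<in>isometries. \<forall>u. blinfun_apply g' u = reflect H (blinfun_apply g u)"
    if "g \<in> isometries" for g
    using reflect_compose_isometry[OF H that] by metis
qed (intro H C compact_fiber_sym fiber_sym_nonempty support_fun_fiber_sym_le)+

text \<open>Rigidity for \<open>fiber_sym H C\<close> against \<open>C\<close> makes the support
  function of \<open>C\<close> invariant. Convexity turns this into an inclusion, and the involution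
  property into equality.\<close>

lemma reflect_image_eq_if_lyapunov_fiber_sym_eq:
  fixes C :: "'a::euclidean_space set"
  assumes H: "subspace H" and C: "compact C" "C \<noteq> {}" "convex C"
    and eq: "lyapunov (fiber_sym H C) = lyapunov C"
  shows "reflect H ` C = C"
proof -
  have sf: "support_fun C (reflect H u) = support_fun C u" for u
    using lyapunov_le_and_rigid(2)[of "fiber_sym H C" C "reflect H"] eq H C
    by (metis compact_fiber_sym fiber_sym_nonempty support_fun_fiber_sym_le reflect_compose_isometry)
  have "reflect H ` C \<subseteq> C"
  proof (rule subset_if_support_fun_le)
    show "compact (reflect H ` C)"
      using linear_reflect[OF H]
      by (intro compact_continuous_image linear_continuous_on C) (simp add: linear_conv_bounded_linear)
    show "support_fun (reflect H ` C) u \<le> support_fun C u" for u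
      using C inner_le_support_fun[OF C(1), of _ "reflect H u"]
      by (intro support_fun_leI) (auto simp: inner_reflect_left[OF H] sf)
  qed (use C in auto)
  moreover from this have "reflect H ` reflect H ` C \<subseteq> reflect H ` C" by blast
  ultimately show ?thesis by (auto simp: image_image reflect_reflect[OF H])
qed

text \<open>With \<open>id\<close> for \<open>R\<close> the averaged bound is monotonicity of
  support functions, and rigidity becomes strict monotonicity of \<open>lyapunov\<close>.\<close>

lemma eq_if_subset_lyapunov_eq:
  fixes C D :: "'a::euclidean_space set"
  assumes C: "compact C" "C \<noteq> {}" and D: "compact D" "convex D" and CD: "convex C" "C \<subseteq> D"
    and eq: "lyapunov C = lyapunov D"
  shows "C = D"
proof -
  have "D \<noteq> {}" using C CD by blast
  have "support_fun C u \<le> (support_fun D u + support_fun D (id u)) / 2" for u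
    using C CD inner_le_support_fun[OF D(1), of _ u] by (intro support_fun_leI) auto
  then have "support_fun C = support_fun D"
    using lyapunov_le_and_rigid(2)[OF C D(1) \<open>D \<noteq> {}\<close>, of id] eq by auto
  then have "D \<subseteq> C" by (intro subset_if_support_fun_le C D CD) simp
  with CD show ?thesis by blast
qed

lemma lyapunov_mono:
  fixes C D :: "'a::euclidean_space set"
  assumes C: "C \<noteq> {}" "compact C" and D: "compact D" and CD: "C \<subseteq> D"
  shows "lyapunov C \<le> lyapunov D"
proof (rule lyapunov_le_and_rigid(1)[of _ _ id])
  show "support_fun C u \<le> (support_fun D u + support_fun D (id u)) / 2" for u
    using C CD inner_le_support_fun[OF D(1), of _ u] by (intro support_fun_leI) auto
qed (use assms in auto)

text \<open>An additive error in the support function becomes a factor under \<open>exp\<close>.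
  Isometries keep norms, and vectors of the box have norm at most that of
  \<open>One\<close>.\<close>

lemma lyapunov_nbhd_within:
  fixes C D :: "'a::euclidean_space set"
  assumes C: "compact C" "C \<noteq> {}" and D: "compact D" "D \<noteq> {}" and e: "0 \<le> e" "nbhd_within e C D"
  shows "lyapunov C \<le> exp (e * norm (One::'a)) * lyapunov D"
proof -
  obtain g where g: "g \<in> isometries" "lyapunov C = exp_support C g"
    using lyapunov_attained[OF C] by blast
  have "exp (support_fun C (blinfun_apply g u))
      \<le> exp (e * norm (One::'a)) * exp (support_fun D (blinfun_apply g u))" if "u \<in> unit_box" for u
  proof -
    have "norm u \<le> norm (One::'a)"
      using that by (intro norm_le_componentwise) (auto simp: mem_box abs_le_iff)
    then have "e * norm (blinfun_apply g u) \<le> e * norm (One::'a)"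
      using g(1) e(1) by (simp add: isometries_def mult_left_mono)
    then show ?thesis
      using support_fun_nbhd_within[OF C(2) D(1) e(2), of "blinfun_apply g u"]
      by (simp add: exp_add[symmetric])
  qed
  then have "exp_support C g \<le> integral unit_box (\<lambda>u. exp (e * norm (One::'a)) * exp (support_fun D (blinfun_apply g u)))"
    unfolding exp_support_def
    by (intro integral_le) (auto simp: integrable_exp_support_integrand C D)
  also have "\<dots> = exp (e * norm (One::'a)) * exp_support D g"
    by (simp add: exp_support_def)
  also have "\<dots> \<le> exp (e * norm (One::'a)) * lyapunov D"
    by (simp add: exp_support_le_lyapunov[OF D g(1)])
  finally show ?thesis by (simp add: g(2))
qed

section \<open>Hausdorff convergence\<close>

text \<open>Avoids suprema and lets each half of the closeness be used alone;
  \<open>hausdorff_dist_tendsto_0\<close> translates back.\<close>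

definition hausdorff_tendsto :: "(nat \<Rightarrow> 'a::metric_space set) \<Rightarrow> 'a set \<Rightarrow> bool" where
  "hausdorff_tendsto X L \<longleftrightarrow>
     (\<forall>e>0. \<forall>\<^sub>F j in sequentially. nbhd_within e (X j) L \<and> nbhd_within e L (X j))"

lemma infdist_le_if_nbhd_within:
  assumes "nbhd_within e A B" "a \<in> A"
  shows "infdist a B \<le> e"
  using assms infdist_le2 unfolding nbhd_within_def by metis

text \<open>Real suprema are meaningful only for nonempty bounded sets; closeness supplies the bound
  on the distances.\<close>

lemma hausdorff_dist_bounds:
  assumes "A \<noteq> {}" "B \<noteq> {}" "nbhd_within e A B" "nbhd_within e B A"
  shows "0 \<le> hausdorff_dist A B" "hausdorff_dist A B \<le> e"
proof -
  have A: "infdist a B \<le> e" if "a \<in> A" for a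
    using infdist_le_if_nbhd_within[OF assms(3) that] .
  have B: "infdist b A \<le> e" if "b \<in> B" for b
    using infdist_le_if_nbhd_within[OF assms(4) that] .
  show "hausdorff_dist A B \<le> e"
    unfolding hausdorff_dist_def using A B assms by (auto intro!: cSUP_least)
  obtain a where a: "a \<in> A" using assms by blast
  have "0 \<le> infdist a B" by (rule infdist_nonneg)
  also have "\<dots> \<le> (SUP a\<in>A. infdist a B)"
    using A a by (intro cSUP_upper bdd_aboveI2) auto
  finally show "0 \<le> hausdorff_dist A B" by (simp add: hausdorff_dist_def)
qed

lemma hausdorff_dist_tendsto_0:
  assumes "hausdorff_tendsto X L" "\<And>j. X j \<noteq> {}" "L \<noteq> {}"
  shows "(\<lambda>j. hausdorff_dist (X j) L) \<longlonglongrightarrow> 0"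
proof (rule tendstoI)
  fix e :: real assume e: "e > 0"
  have "\<forall>\<^sub>F j in sequentially. nbhd_within (e/2) (X j) L \<and> nbhd_within (e/2) L (X j)"
    using assms(1) e by (simp add: hausdorff_tendsto_def)
  then show "\<forall>\<^sub>F j in sequentially. dist (hausdorff_dist (X j) L) 0 < e"
  proof eventually_elim
    case (elim j)
    then show ?case using hausdorff_dist_bounds[OF assms(2)[of j] assms(3)] e by fastforce
  qed
qed

section \<open>Limits under Hausdorff convergence\<close>

lemma subset_if_nbhd_within:
  assumes "closed B" "\<And>e. e > 0 \<Longrightarrow> nbhd_within e A B"
  shows "A \<subseteq> B"
proof
  fix a assume a: "a \<in> A"
  have "B \<noteq> {}" using assms(2)[of 1] a by (auto simp: nbhd_within_def)
  moreover have "infdist a B \<le> 0"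
    by (rule field_le_epsilon) (simp add: infdist_le_if_nbhd_within[OF assms(2) a])
  ultimately show "a \<in> B"
    using in_closed_iff_infdist_zero[OF assms(1)] infdist_nonneg[of a B] by fastforce
qed

lemma nbhd_within_trans:
  assumes "nbhd_within d A B" "nbhd_within e B C"
  shows "nbhd_within (d + e) A C"
  unfolding nbhd_within_def
proof
  fix a assume "a \<in> A"
  then obtain b c where "b \<in> B" "dist a b \<le> d" "c \<in> C" "dist b c \<le> e"
    using assms unfolding nbhd_within_def by meson
  then show "\<exists>c\<in>C. dist a c \<le> d + e"
    using dist_triangle[of a c b] by (intro bexI[of _ c]) auto
qed

lemma hausdorff_limit_subset:
  assumes "closed L" "hausdorff_tendsto X M"
    and "\<And>e. e > 0 \<Longrightarrow> \<forall>\<^sub>F j in sequentially. nbhd_within e (X j) L"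
  shows "M \<subseteq> L"
proof (rule subset_if_nbhd_within[OF assms(1)])
  fix e :: real assume e: "e > 0"
  then have "\<forall>\<^sub>F j in sequentially. nbhd_within (e/2) (X j) L"
    "\<forall>\<^sub>F j in sequentially. nbhd_within (e/2) (X j) M \<and> nbhd_within (e/2) M (X j)"
    using assms(2) assms(3)[of "e/2"] unfolding hausdorff_tendsto_def by simp_all
  then have "\<forall>\<^sub>F j in sequentially. nbhd_within (e/2) (X j) L \<and> nbhd_within (e/2) M (X j)"
    by eventually_elim auto
  then obtain j where "nbhd_within (e/2) (X j) L" "nbhd_within (e/2) M (X j)"
    using eventually_happens'[OF sequentially_bot] by blast
  then show "nbhd_within e M L" using nbhd_within_trans by fastforce
qed

text \<open>Approximate both points in some \<open>X j\<close>, combine there and return to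
  \<open>L\<close>; each passage costs \<open>e/2\<close>.\<close>

lemma convex_hausdorff_limit:
  fixes L :: "'a::real_normed_vector set"
  assumes L: "closed L" and X: "hausdorff_tendsto X L" "\<And>j. convex (X j)"
  shows "convex L"
proof (rule convexI)
  fix x y and u v :: real assume xy: "x \<in> L" "y \<in> L" and uv: "0 \<le> u" "0 \<le> v" "u + v = 1"
  have "{u *\<^sub>R x + v *\<^sub>R y} \<subseteq> L"
  proof (rule subset_if_nbhd_within[OF L])
    fix e :: real assume e: "e > 0"
    then have "\<forall>\<^sub>F j in sequentially. nbhd_within (e/2) (X j) L \<and> nbhd_within (e/2) L (X j)"
      using X(1) by (simp add: hausdorff_tendsto_def)
    then obtain j where j: "nbhd_within (e/2) (X j) L" "nbhd_within (e/2) L (X j)"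
      using eventually_happens'[OF sequentially_bot] by blast
    obtain x' y' where x': "x' \<in> X j" "dist x x' \<le> e/2" and y': "y' \<in> X j" "dist y y' \<le> e/2"
      using j(2) xy unfolding nbhd_within_def by meson
    have "u *\<^sub>R x' + v *\<^sub>R y' \<in> X j" using X(2) x' y' uv by (auto intro: convexD)
    moreover have "dist (u *\<^sub>R x + v *\<^sub>R y) (u *\<^sub>R x' + v *\<^sub>R y') \<le> e/2"
    proof -
      have "dist (u *\<^sub>R x + v *\<^sub>R y) (u *\<^sub>R x' + v *\<^sub>R y') \<le> u * dist x x' + v * dist y y'"
        using dist_triangle_add[of "u *\<^sub>R x" "v *\<^sub>R y" "u *\<^sub>R x'" "v *\<^sub>R y'"] uv
        by (simp add: dist_norm flip: scaleR_diff_right)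
      also have "\<dots> \<le> u * (e/2) + v * (e/2)" using uv x' y' by (intro add_mono mult_left_mono) auto
      also have "\<dots> = e/2" using uv(3) by (metis distrib_right mult_1)
      finally show ?thesis .
    qed
    ultimately have "nbhd_within (e/2) {u *\<^sub>R x + v *\<^sub>R y} (X j)" unfolding nbhd_within_def by blast
    from nbhd_within_trans[OF this j(1)] show "nbhd_within e {u *\<^sub>R x + v *\<^sub>R y} L" by simp
  qed
  then show "u *\<^sub>R x + v *\<^sub>R y \<in> L" by simp
qed

text \<open>The distance functions of the sets are 1-Lipschitz and uniformly bounded on the ball, so
  Arzela-Ascoli yields a uniform limit \<open>g\<close> along a subsequence. The zero set of
  \<open>g\<close> is the limit set.\<close>

theorem Blaschke_selection:
  fixes X :: "nat \<Rightarrow> 'a::euclidean_space set"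
  assumes X: "\<And>n. compact (X n)" "\<And>n. X n \<noteq> {}" "\<And>n. X n \<subseteq> cball 0 r"
  obtains k L where "strict_mono k" "compact L" "L \<noteq> {}" "hausdorff_tendsto (X \<circ> k) L"
proof -
  have bound: "norm (infdist x (X n)) \<le> 2 * r" if "x \<in> cball 0 r" for n x
  proof -
    obtain a where a: "a \<in> X n" using X(2) by blast
    have "infdist x (X n) \<le> dist x a" by (rule infdist_le[OF a])
    also have "\<dots> \<le> norm x + norm a" by (simp add: dist_norm norm_triangle_ineq4)
    also have "\<dots> \<le> 2 * r" using that a X(3)[of n] by (auto simp: subset_iff)
    finally show ?thesis by (simp add: infdist_nonneg)
  qed
  have equi: "\<exists>d>0. \<forall>n y. y \<in> cball 0 r \<and> norm (x - y) < d \<longrightarrow> norm (infdist x (X n) - infdist y (X n)) < e"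
    if "e > 0" for x e
  proof (intro exI[of _ e] conjI allI impI that)
    fix n y assume "y \<in> cball 0 r \<and> norm (x - y) < e"
    then show "norm (infdist x (X n) - infdist y (X n)) < e"
      using infdist_triangle_abs[of x "X n" y] by (simp add: dist_norm)
  qed
  obtain g k where g: "continuous_on (cball 0 r) g" and k: "strict_mono (k :: nat \<Rightarrow> nat)"
    and unif: "\<And>e. 0 < e \<Longrightarrow> \<exists>N. \<forall>n x. n \<ge> N \<and> x \<in> cball 0 r \<longrightarrow> norm (infdist x (X (k n)) - g x) < e"
    using Arzela_Ascoli[of "cball 0 r" "\<lambda>n x. infdist x (X n)" "2 * r", OF compact_cball bound equi] by blast
  define L where "L = {x \<in> cball 0 r. g x = 0}"
  have "L = cball 0 r \<inter> g -` {0}" by (auto simp: L_def)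
  then have L: "compact L"
    using continuous_closed_preimage[OF g, of "{0}"] by (metis bounded_cball bounded_subset closed_cball
        closed_singleton compact_eq_bounded_closed inf_le1)
  \<comment> \<open>Points of \<open>X (k n)\<close> nearest to \<open>x\<close> accumulate at some
    \<open>l\<close>; there \<open>g\<close> vanishes, and their distances to \<open>x\<close> tend
    to both \<open>g x\<close> and \<open>dist x l\<close>.\<close>
  have nearest: "\<exists>l\<in>L. dist x l = g x" if x: "x \<in> cball 0 r" for x
  proof -
    have "\<exists>y. y \<in> X (k n) \<and> infdist x (X (k n)) = dist x y" for n
      using infdist_attains_inf[OF compact_imp_closed[OF X(1)] X(2), of "k n" x] by metis
    then obtain y where y: "\<And>n. y n \<in> X (k n)" "\<And>n. infdist x (X (k n)) = dist x (y n)" by metis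
    have yS: "y n \<in> cball 0 r" for n using y(1) X(3) by blast
    then obtain l s where l: "l \<in> cball 0 r" "strict_mono s" "(y \<circ> s) \<longlonglongrightarrow> l"
      using compact_cball[of 0 r] unfolding compact_def by metis
    \<comment> \<open>Uniform convergence permits arguments varying with \<open>n\<close>, as needed
      at the nearest points.\<close>
    have conv: "(\<lambda>n. infdist (z n) (X (k n)) - g (z n)) \<longlonglongrightarrow> 0" if "\<And>n. z n \<in> cball 0 r" for z
    proof (rule LIMSEQ_I)
      fix e :: real assume "e > 0"
      then obtain N where "\<forall>n x. n \<ge> N \<and> x \<in> cball 0 r \<longrightarrow> norm (infdist x (X (k n)) - g x) < e"
        using unif by blast
      then show "\<exists>N. \<forall>n\<ge>N. norm (infdist (z n) (X (k n)) - g (z n) - 0) < e"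
        using that by auto
    qed
    have "(\<lambda>n. g (y (s n))) \<longlonglongrightarrow> g l"
      using continuous_on_tendsto_compose[OF g, of "y \<circ> s" l] l yS by (auto simp: o_def)
    moreover have "(\<lambda>n. - g (y n)) \<longlonglongrightarrow> 0" using conv[of y] yS y(1) by simp
    then have "(\<lambda>n. - g (y (s n))) \<longlonglongrightarrow> 0" using LIMSEQ_subseq_LIMSEQ[OF _ l(2)] by (force simp: o_def)
    then have "(\<lambda>n. g (y (s n))) \<longlonglongrightarrow> 0" using tendsto_minus_cancel_left[of _ 0] by force
    ultimately have "g l = 0" by (rule LIMSEQ_unique)
    have "(\<lambda>n. dist x (y n)) \<longlonglongrightarrow> g x"
      using conv[of "\<lambda>_. x"] x by (simp add: y(2) LIM_zero_iff)
    then have "(\<lambda>n. dist x (y (s n))) \<longlonglongrightarrow> g x" using LIMSEQ_subseq_LIMSEQ[OF _ l(2)] by (force simp: o_def)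
    moreover have "(\<lambda>n. dist x (y (s n))) \<longlonglongrightarrow> dist x l"
      using l(3) by (intro tendsto_dist tendsto_const) (simp add: o_def)
    ultimately have "dist x l = g x" by (metis LIMSEQ_unique)
    with \<open>g l = 0\<close> l(1) show ?thesis by (auto simp: L_def)
  qed
  have "hausdorff_tendsto (X \<circ> k) L"
    unfolding hausdorff_tendsto_def
  proof (intro allI impI)
    fix e :: real assume "e > 0"
    then obtain N where N: "\<And>n x. n \<ge> N \<Longrightarrow> x \<in> cball 0 r \<Longrightarrow> norm (infdist x (X (k n)) - g x) < e"
      using unif by blast
    have "nbhd_within e (X (k n)) L \<and> nbhd_within e L (X (k n))" if n: "n \<ge> N" for n
    proof
      show "nbhd_within e (X (k n)) L"
        unfolding nbhd_within_def
      proof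
        fix a assume a: "a \<in> X (k n)"
        then have aS: "a \<in> cball 0 r" using X(3) by blast
        obtain l where "l \<in> L" "dist a l = g a" using nearest[OF aS] by blast
        moreover have "\<bar>g a\<bar> < e" using N[OF n aS] a by simp
        ultimately show "\<exists>l\<in>L. dist a l \<le> e" by force
      qed
      show "nbhd_within e L (X (k n))"
        unfolding nbhd_within_def
      proof
        fix l assume "l \<in> L"
        then have l: "l \<in> cball 0 r" "g l = 0" by (auto simp: L_def)
        obtain a where "a \<in> X (k n)" "infdist l (X (k n)) = dist l a"
          using infdist_attains_inf[OF compact_imp_closed[OF X(1)] X(2)] by metis
        then show "\<exists>a\<in>X (k n). dist l a \<le> e" using N[OF n l(1)] l(2) by force
      qed
    qed
    then show "\<forall>\<^sub>F j in sequentially. nbhd_within e ((X \<circ> k) j) L \<and> nbhd_within e L ((X \<circ> k) j)"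
      unfolding eventually_sequentially by auto
  qed
  moreover have "L \<noteq> {}" using nearest X(2,3) by blast
  ultimately show thesis using that k L by blast
qed

section \<open>Convergence of iterated symmetrizations\<close>

text \<open>Continuity of \<open>lyapunov\<close>: closeness bounds each value by the other up to a
  factor tending to 1 with \<open>e\<close>.\<close>

lemma lyapunov_hausdorff_limit:
  fixes L :: "'a::euclidean_space set"
  assumes X: "\<And>j. compact (X j)" "\<And>j. X j \<noteq> {}" and L: "compact L" "L \<noteq> {}"
    and lim: "hausdorff_tendsto X L" "(\<lambda>j. lyapunov (X j)) \<longlonglongrightarrow> w"
  shows "lyapunov L = w"
proof -
  have bounds: "lyapunov L \<le> exp (e * norm (One::'a)) * w \<and> w \<le> exp (e * norm (One::'a)) * lyapunov L"
    if e: "e > 0" for e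
  proof
    have ev: "\<forall>\<^sub>F j in sequentially. nbhd_within e (X j) L \<and> nbhd_within e L (X j)"
      using lim(1) e by (simp add: hausdorff_tendsto_def)
    have "\<forall>\<^sub>F j in sequentially. lyapunov L \<le> exp (e * norm (One::'a)) * lyapunov (X j)"
      using ev by eventually_elim (use e X L in \<open>auto intro: lyapunov_nbhd_within\<close>)
    then show "lyapunov L \<le> exp (e * norm (One::'a)) * w"
      by (intro tendsto_lowerbound[OF tendsto_mult[OF tendsto_const lim(2)]]) auto
    have "\<forall>\<^sub>F j in sequentially. lyapunov (X j) \<le> exp (e * norm (One::'a)) * lyapunov L"
      using ev by eventually_elim (use e X L in \<open>auto intro: lyapunov_nbhd_within\<close>)
    then show "w \<le> exp (e * norm (One::'a)) * lyapunov L"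
      by (intro tendsto_upperbound[OF lim(2)]) auto
  qed
  have tends: "((\<lambda>e. exp (e * norm (One::'a)) * c) \<longlongrightarrow> c) (at_right 0)" for c :: real
    by (auto intro!: tendsto_eq_intros)
  have ev: "\<forall>\<^sub>F e::real in at_right 0. 0 < e" by (rule eventually_at_right_less)
  show ?thesis
  proof (rule antisym)
    have "\<forall>\<^sub>F e in at_right 0. lyapunov L \<le> exp (e * norm (One::'a)) * w"
      using ev by eventually_elim (use bounds in blast)
    then show "lyapunov L \<le> w" by (rule tendsto_lowerbound[OF tends]) simp
    have "\<forall>\<^sub>F e in at_right 0. w \<le> exp (e * norm (One::'a)) * lyapunov L"
      using ev by eventually_elim (use bounds in blast)
    then show "w \<le> lyapunov L" by (rule tendsto_lowerbound[OF tends]) simp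
  qed
qed

lemma constant_subsequence_of_finite_range:
  fixes f :: "nat \<Rightarrow> 'b"
  assumes "finite A" "range f \<subseteq> A"
  obtains a s where "strict_mono (s :: nat \<Rightarrow> nat)" "\<And>n. f (s n) = a"
proof -
  have "finite (range f)" using assms finite_subset by blast
  then obtain n0 where "infinite {n \<in> UNIV. f n = f n0}"
    using pigeonhole_infinite[of "UNIV :: nat set" f] by auto
  then have inf: "infinite {n. f n = f n0}" by simp
  show thesis
    using that[OF strict_mono_enumerate[OF inf], of "f n0"] enumerate_in_set[OF inf] by blast
qed

text \<open>The convex case: \<open>X\<close> will be the iteration from
  \<open>convex hull K\<close>, which agrees with that from \<open>K\<close> after one step.\<close>

locale fiber_sym_sequence =
  fixes \<F> :: "'a::euclidean_space set set" and Hs :: "nat \<Rightarrow> 'a set" and X :: "nat \<Rightarrow> 'a set"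
  assumes finite_family: "finite \<F>"
    and subspaces: "Q \<in> \<F> \<Longrightarrow> subspace Q"
    and Hs_in: "Hs m \<in> \<F>"
    and compact_0: "compact (X 0)" and nonempty_0: "X 0 \<noteq> {}" and convex_0: "convex (X 0)"
    and X_Suc: "X (Suc m) = fiber_sym (Hs m) (X m)"
begin

lemma subspace_Hs: "subspace (Hs m)"
  using subspaces Hs_in by blast

lemma compact_X: "compact (X m)" and nonempty_X: "X m \<noteq> {}" and convex_X: "convex (X m)"
  by (induction m) (use compact_0 nonempty_0 convex_0 in
    \<open>simp_all add: X_Suc compact_fiber_sym fiber_sym_nonempty convex_fiber_sym subspace_Hs\<close>)

lemma X_bounded: obtains r where "\<And>m. X m \<subseteq> cball 0 r"
proof -
  obtain r where r: "X 0 \<subseteq> cball 0 r"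
    using compact_imp_bounded[OF compact_0] bounded_subset_ballD[of "X 0" 0] ball_subset_cball by blast
  have "X m \<subseteq> cball 0 r" for m
    by (induction m) (use r in \<open>simp_all add: X_Suc fiber_sym_subset_cball subspace_Hs\<close>)
  then show thesis using that by blast
qed

text \<open>\<open>t\<close> is arbitrary so that limits can be extracted along times chosen
  beforehand.\<close>

lemma convergent_subsequence:
  fixes t :: "nat \<Rightarrow> nat"
  obtains k L where "strict_mono k" "compact L" "L \<noteq> {}" "convex L" "hausdorff_tendsto (\<lambda>j. X (t (k j))) L"
proof -
  obtain r where r: "\<And>m. X m \<subseteq> cball 0 r" using X_bounded by blast
  obtain k L where kL: "strict_mono k" "compact L" "L \<noteq> {}" "hausdorff_tendsto ((\<lambda>j. X (t j)) \<circ> k) L"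
    by (rule Blaschke_selection[of "\<lambda>j. X (t j)" r]) (simp_all add: compact_X nonempty_X r)
  moreover have "convex L"
    by (rule convex_hausdorff_limit[OF compact_imp_closed[OF kL(2)] kL(4)]) (simp add: convex_X)
  ultimately show thesis using that by (simp add: o_def)
qed

text \<open>The sequence is decreasing and nonnegative, which gives \<open>lim\<close> its meaning
  here.\<close>

definition limit_value :: real where
  "limit_value = lim (\<lambda>m. lyapunov (X m))"

lemma lyapunov_X_tendsto: "(\<lambda>m. lyapunov (X m)) \<longlonglongrightarrow> limit_value"
proof -
  have "decseq (\<lambda>m. lyapunov (X m))"
    by (intro decseq_SucI) (simp add: X_Suc lyapunov_fiber_sym_le subspace_Hs compact_X nonempty_X)
  moreover have "0 \<le> lyapunov (X m)" for m
    by (simp add: lyapunov_nonneg compact_X nonempty_X)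
  ultimately have "convergent (\<lambda>m. lyapunov (X m))"
    by (metis decseq_convergent convergentI)
  then show ?thesis by (simp add: limit_value_def convergent_LIMSEQ_iff)
qed

text \<open>Only divergence of \<open>t\<close> is required, because first times of an event need
  not be strictly increasing.\<close>

lemma lyapunov_limit:
  assumes "filterlim t at_top sequentially" "compact L" "L \<noteq> {}" "hausdorff_tendsto (\<lambda>j. X (t j)) L"
  shows "lyapunov L = limit_value"
  using lyapunov_hausdorff_limit[OF _ _ assms(2-4)] compact_X nonempty_X
    filterlim_compose[OF lyapunov_X_tendsto assms(1)] by blast

text \<open>One-sided closeness to a limit body is enough: any limit is then contained in \<open>L\<close>
  and has the same Lyapunov value.\<close>

lemma tendsto_if_nbhd_within:
  assumes t: "filterlim t at_top sequentially" and L: "compact L" "L \<noteq> {}" "convex L"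
    and val: "lyapunov L = limit_value"
    and near: "\<And>e. e > 0 \<Longrightarrow> \<forall>\<^sub>F j in sequentially. nbhd_within e (X (t j)) L"
  shows "hausdorff_tendsto (\<lambda>j. X (t j)) L"
proof (rule ccontr)
  assume "\<not> hausdorff_tendsto (\<lambda>j. X (t j)) L"
  then obtain e where e: "e > 0"
    "\<exists>\<^sub>F j in sequentially. \<not> (nbhd_within e (X (t j)) L \<and> nbhd_within e L (X (t j)))"
    by (auto simp: hausdorff_tendsto_def frequently_def)
  then have inf: "infinite {j. \<not> (nbhd_within e (X (t j)) L \<and> nbhd_within e L (X (t j)))}"
    by (simp add: cofinite_eq_sequentially[symmetric] frequently_cofinite)
  \<comment> \<open>\<open>s\<close> runs through the indices where closeness fails; a further
    subsequence will nevertheless converge to \<open>L\<close>.\<close>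
  define s where "s = enumerate {j. \<not> (nbhd_within e (X (t j)) L \<and> nbhd_within e L (X (t j)))}"
  have s: "strict_mono s" "\<And>j. \<not> (nbhd_within e (X (t (s j))) L \<and> nbhd_within e L (X (t (s j))))"
    using strict_mono_enumerate[OF inf] enumerate_in_set[OF inf] by (auto simp: s_def)
  obtain k M where k: "strict_mono k" and M: "compact M" "M \<noteq> {}" "convex M"
    and kM: "hausdorff_tendsto (\<lambda>j. X (t (s (k j)))) M"
    using convergent_subsequence[of "\<lambda>j. t (s j)"] by blast
  have sk: "strict_mono (\<lambda>j. s (k j))" using strict_mono_compose[OF s(1) k] by simp
  have "M \<subseteq> L"
  proof (rule hausdorff_limit_subset[OF compact_imp_closed[OF L(1)] kM])
    show "\<forall>\<^sub>F j in sequentially. nbhd_within e (X (t (s (k j)))) L" if "e > 0" for e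
      using eventually_subseq[OF sk near[OF that]] .
  qed
  moreover have "lyapunov M = limit_value"
    using lyapunov_limit[OF _ M(1,2) kM] filterlim_compose[OF t filterlim_subseq[OF sk]] by simp
  ultimately have "M = L" using eq_if_subset_lyapunov_eq[OF M(1,2) L(1,3) M(3)] val by simp
  then have "\<forall>\<^sub>F j in sequentially. nbhd_within e (X (t (s (k j)))) L \<and> nbhd_within e L (X (t (s (k j))))"
    using kM e(1) by (simp add: hausdorff_tendsto_def)
  then show False using s(2) eventually_happens'[OF sequentially_bot] by blast
qed

text \<open>The same \<open>e\<close> survives every invariant step, so arbitrarily long runs are
  harmless.\<close>

lemma nbhd_within_propagates:
  assumes L: "convex L" and "m \<le> n" and sym: "\<And>i. m \<le> i \<Longrightarrow> i < n \<Longrightarrow> reflect (Hs i) ` L = L"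
    and near: "nbhd_within e (X m) L"
  shows "nbhd_within e (X n) L"
  using \<open>m \<le> n\<close> sym
proof (induction n rule: dec_induct)
  case base then show ?case by (simp add: near)
next
  case (step n)
  then show ?case
    by (simp add: X_Suc fiber_sym_nbhd_within[OF subspace_Hs L])
qed

text \<open>The contradiction concerns the first subspace from time \<open>r j\<close> on that moves
  \<open>L\<close>, which may differ from \<open>Q\<close>; the recurrence of \<open>Q\<close>
  guarantees that such a time exists.\<close>

lemma reflect_limit:
  assumes r: "strict_mono r" and L: "compact L" "L \<noteq> {}" "convex L"
    and lim: "hausdorff_tendsto (\<lambda>j. X (r j)) L"
    and Q: "\<exists>\<^sub>F m in sequentially. Hs m = Q"
  shows "reflect Q ` L = L"
proof (rule ccontr)
  assume Q': "reflect Q ` L \<noteq> L"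
  have val: "lyapunov L = limit_value"
    by (rule lyapunov_limit[OF filterlim_subseq[OF r] L(1,2) lim])
  define t where "t j = (LEAST m. r j \<le> m \<and> reflect (Hs m) ` L \<noteq> L)" for j
  have ex: "\<exists>m. r j \<le> m \<and> reflect (Hs m) ` L \<noteq> L" for j
    using Q Q' unfolding frequently_sequentially by blast
  have t: "r j \<le> t j" "reflect (Hs (t j)) ` L \<noteq> L" for j
    using LeastI_ex[OF ex, of j] by (auto simp: t_def)
  have t_least: "reflect (Hs i) ` L = L" if "r j \<le> i" "i < t j" for i j
    using not_less_Least[of i] that unfolding t_def by blast
  have t_lim: "filterlim t at_top sequentially"
    by (rule filterlim_at_top_mono[OF filterlim_subseq[OF r]]) (simp add: t(1))
  have near_t: "\<forall>\<^sub>F j in sequentially. nbhd_within e (X (t j)) L" if e: "e > 0" for e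
  proof -
    have "\<forall>\<^sub>F j in sequentially. nbhd_within e (X (r j)) L \<and> nbhd_within e L (X (r j))"
      using lim e by (simp add: hausdorff_tendsto_def)
    then show ?thesis
    proof eventually_elim
      case (elim j)
      show ?case
        by (rule nbhd_within_propagates[OF L(3) t(1)[of j] t_least[of j]]) (use elim in auto)
    qed
  qed
  \<comment> \<open>Upper semicontinuity concerns one fixed symmetrization, so a single
    \<open>H\<close> is selected by pigeonhole.\<close>
  have "range (\<lambda>j. Hs (t j)) \<subseteq> \<F>" using Hs_in by blast
  from constant_subsequence_of_finite_range[OF finite_family this]
  obtain H s where s: "strict_mono (s :: nat \<Rightarrow> nat)" "\<And>j. Hs (t (s j)) = H" by metis
  have H: "subspace H" using s(2) subspace_Hs by metis
  \<comment> \<open>\<open>M\<close> is a limit one step later, just after \<open>H\<close> has been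
    applied.\<close>
  obtain k M where k: "strict_mono k" and M: "compact M" "M \<noteq> {}" "convex M"
    and kM: "hausdorff_tendsto (\<lambda>j. X (Suc (t (s (k j))))) M"
    using convergent_subsequence[of "\<lambda>j. Suc (t (s j))"] by blast
  have sk: "strict_mono (\<lambda>j. s (k j))" using strict_mono_compose[OF s(1) k] by simp
  have tsk: "filterlim (\<lambda>j. t (s (k j))) at_top sequentially"
    using filterlim_compose[OF t_lim filterlim_subseq[OF sk]] by simp
  have "M \<subseteq> fiber_sym H L"
  proof (rule fiber_sym_upper_semicontinuous[OF H L(1), of "\<lambda>j. X (t (s (k j)))"])
    fix e :: real assume e: "e > 0"
    show "\<forall>\<^sub>F j in sequentially. nbhd_within e (X (t (s (k j)))) L"
      by (rule eventually_subseq[OF sk near_t[OF e]])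
    have "\<forall>\<^sub>F j in sequentially. nbhd_within e (X (Suc (t (s (k j))))) M \<and> nbhd_within e M (X (Suc (t (s (k j)))))"
      using kM e by (simp add: hausdorff_tendsto_def)
    then show "\<forall>\<^sub>F j in sequentially. nbhd_within e M (fiber_sym H (X (t (s (k j)))))"
      by eventually_elim (simp add: X_Suc s(2))
  qed
  \<comment> \<open>Both ends of
    \<open>lyapunov M \<le> lyapunov (fiber_sym H L) \<le> lyapunov L\<close> equal
    \<open>limit_value\<close>, so the equality case makes \<open>L\<close> invariant under
    \<open>H\<close>.\<close>
  then have "lyapunov M \<le> lyapunov (fiber_sym H L)"
    by (intro lyapunov_mono compact_fiber_sym M H L)
  moreover have "lyapunov M = limit_value"
    using lyapunov_limit[OF _ M(1,2) kM] filterlim_compose[OF filterlim_Suc tsk] by simp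
  moreover have "lyapunov (fiber_sym H L) \<le> lyapunov L"
    by (rule lyapunov_fiber_sym_le[OF H L(1,2)])
  ultimately have "lyapunov (fiber_sym H L) = lyapunov L" using val by simp
  then have "reflect H ` L = L"
    by (rule reflect_image_eq_if_lyapunov_fiber_sym_eq[OF H L])
  then show False using t(2)[of "s 0"] s(2) by simp
qed

theorem converges:
  obtains L where "compact L" "convex L" "L \<noteq> {}" "hausdorff_tendsto X L"
    "\<And>Q. \<exists>\<^sub>F m in sequentially. Hs m = Q \<Longrightarrow> reflect Q ` L = L"
proof -
  obtain r L where r: "strict_mono r" and L: "compact L" "L \<noteq> {}" "convex L"
    and lim: "hausdorff_tendsto (\<lambda>j. X (r j)) L"
    using convergent_subsequence[of "\<lambda>j. j"] by blast
  have sym: "reflect Q ` L = L" if "\<exists>\<^sub>F m in sequentially. Hs m = Q" for Q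
    by (rule reflect_limit[OF r L lim that])
  \<comment> \<open>Each subspace moving \<open>L\<close> occurs finitely often, and the family is
    finite, so all of them are eventually absent.\<close>
  have "\<forall>\<^sub>F m in sequentially. \<forall>Q\<in>{Q \<in> \<F>. reflect Q ` L \<noteq> L}. Hs m \<noteq> Q"
  proof (rule eventually_ball_finite)
    show "\<forall>Q\<in>{Q \<in> \<F>. reflect Q ` L \<noteq> L}. \<forall>\<^sub>F m in sequentially. Hs m \<noteq> Q"
      using sym by (auto simp: frequently_def)
  qed (simp add: finite_family)
  then obtain N where "\<And>m. m \<ge> N \<Longrightarrow> \<forall>Q\<in>{Q \<in> \<F>. reflect Q ` L \<noteq> L}. Hs m \<noteq> Q"
    unfolding eventually_sequentially by blast
  then have N: "reflect (Hs m) ` L = L" if "m \<ge> N" for m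
    using that Hs_in by blast
  have "hausdorff_tendsto (\<lambda>j. X j) L"
  proof (rule tendsto_if_nbhd_within[OF filterlim_ident L])
    show "lyapunov L = limit_value"
      by (rule lyapunov_limit[OF filterlim_subseq[OF r] L(1,2) lim])
    fix e :: real assume "e > 0"
    then have "\<forall>\<^sub>F j in sequentially. nbhd_within e (X (r j)) L \<and> nbhd_within e L (X (r j))"
      using lim by (simp add: hausdorff_tendsto_def)
    then have "\<forall>\<^sub>F j in sequentially. nbhd_within e (X (r j)) L \<and> j \<ge> N"
      using eventually_ge_at_top[of N] by eventually_elim simp
    then obtain j where j: "nbhd_within e (X (r j)) L" "j \<ge> N"
      using eventually_happens'[OF sequentially_bot] by blast
    \<comment> \<open>A strictly increasing \<open>r\<close> satisfies \<open>j \<le> r j\<close>,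
      so closeness at \<open>X (r j)\<close> propagates through invariant steps only.\<close>
    have "r j \<ge> N" using j(2) seq_suble[OF r, of j] by linarith
    then have "nbhd_within e (X m) L" if "m \<ge> r j" for m
      using nbhd_within_propagates[OF L(3) that N j(1)] by simp
    then show "\<forall>\<^sub>F j in sequentially. nbhd_within e (X j) L"
      unfolding eventually_sequentially by blast
  qed
  then show thesis using that L sym by simp
qed

end

theorem theorem3:
  fixes K :: "'a::euclidean_space set"
    and \<F> :: "'a set set"
    and Hs :: "nat \<Rightarrow> 'a set"
  assumes "compact K" and "K \<noteq> {}"
    and "frontier (convex hull K) \<subseteq> K"
    and "finite \<F>"
    and "\<And>Q. Q \<in> \<F> \<Longrightarrow> subspace Q \<and> 1 \<le> dim Q \<and> dim Q \<le> DIM('a) - 2"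
    and "\<And>m. Hs m \<in> \<F>"
  shows "\<exists>L. compact L \<and> convex L \<and> L \<noteq> {}
           \<and> (\<lambda>m. hausdorff_dist (fsym_iter Hs K m) L) \<longlonglongrightarrow> 0
           \<and> (\<lambda>m. hausdorff_dist (fsym_iter Hs (convex hull K) m) L) \<longlonglongrightarrow> 0
           \<and> (\<forall>Q\<in>\<F>. (\<exists>\<^sub>F m in sequentially. Hs m = Q) \<longrightarrow> reflect Q ` L = L)"
proof -
  let ?X = "fsym_iter Hs (convex hull K)"
  interpret fiber_sym_sequence \<F> Hs ?X
    by unfold_locales (use assms in \<open>auto simp: compact_convex_hull\<close>)
  obtain L where L: "compact L" "convex L" "L \<noteq> {}" "hausdorff_tendsto ?X L"
    "\<And>Q. \<exists>\<^sub>F m in sequentially. Hs m = Q \<Longrightarrow> reflect Q ` L = L"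
    using converges by blast
  have lim: "(\<lambda>m. hausdorff_dist (?X m) L) \<longlonglongrightarrow> 0"
    by (rule hausdorff_dist_tendsto_0[OF L(4) nonempty_X L(3)])
  \<comment> \<open>Subtraction on naturals truncates; \<open>1 \<le> dim Q\<close> rules out small
    dimensions and yields the additive form.\<close>
  have H0: "subspace (Hs 0)" "dim (Hs 0) + 2 \<le> DIM('a)"
    using assms(5)[OF assms(6), of 0] by auto
  \<comment> \<open>The first symmetrization already erases the difference between \<open>K\<close>
    and its hull, hence equality from index 1 on.\<close>
  have eq: "fsym_iter Hs K (Suc m) = ?X (Suc m)" for m
  proof (induction m)
    case 0
    show ?case using fiber_sym_eq_fiber_sym_convex_hull[OF assms(1,3) H0] by simp
  qed simp
  have "(\<lambda>m. hausdorff_dist (?X (Suc m)) L) \<longlonglongrightarrow> 0"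
    by (rule LIMSEQ_Suc[OF lim])
  then have "(\<lambda>m. hausdorff_dist (fsym_iter Hs K m) L) \<longlonglongrightarrow> 0"
    by (subst filterlim_sequentially_Suc[symmetric]) (simp only: eq)
  with lim L show ?thesis by (intro exI[of _ L]) simp
qed

end
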